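(* Let $d\geq 2$, $e\geq 1$ be integers, and suppose that there exists a $\mathbb{C}$-algebra homomorphism (specialization homomorphism) $\psi:\mathbb{C}[x_1,\ldots,x_e]\to\mathbb{C}$ such that 1. $\psi(g_{d+i,e})=0$ for each $0\le i\le e-2$; 2. $\psi(g_{d+e-1,e})\neq 0$; and 3. $\psi(a_{d,e})\neq 0$. Then $\mathcal{G}_{(d+e)}\subset\overline{\mathcal{G}_{(d,e+1)}}$.
   Context: Automorphisms. $\mathcal{G}$ is the group of polynomial automorphisms of the affine plane $\mathbb{C}^2$, written as pairs $(F_1,F_2)\in\mathbb{C}[X,Y]^2$, with group law the composition of maps. $\mathcal{A}\subset\mathcal{G}$ is the subgroup of affine (degree one) automorphisms, and $\mathcal{B}\subset\mathcal{G}$ is the triangular subgroup of automorphisms $(aX+P(Y),bY+c)$ with $a,b\in\mathbb{C}^*$, $c\in\mathbb{C}$, $P\in\mathbb{C}[Y]$. By the Jung-van der Kulk theorem every $\theta\in\mathcal{G}$ can be written $\theta=\alpha_0\tau_1\alpha_1\cdots\tau_k\alpha_k$ with $\alpha_i\in\mathcal{A}$, and $\tau_i\in\mathcal{B}\setminus\mathcal{A}$, reduced in the sense of the amalgamated free product $\mathcal{A}*_{\mathcal{A}\cap\mathcal{B}}\mathcal{B}$ (that is, $\alpha_i\notin\mathcal{B}$ for $0<i<k$); then the sequence $(\deg\tau_1,\ldots,\deg\tau_k)$ depends only on $\theta$ and is called the polydegree of $\theta$ (degree of an automorphism = maximum of the degrees of its components). $\mathcal{G}_{(d_1,\ldots,d_k)}$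 is the set of automorphisms of polydegree $(d_1,\ldots,d_k)$. Topology. $\mathcal{G}$ is an ind-variety: $\mathcal{G}=\bigcup_n\mathcal{G}_{\le n}$, where $\mathcal{G}_{\le n}$ is the set of automorphisms of degree at most $n$, a locally closed subset of the finite-dimensional space of pairs of polynomials of degree at most $n$. A subset of $\mathcal{G}$ is closed iff its intersection with every $\mathcal{G}_{\le n}$ is Zariski closed in $\mathcal{G}_{\le n}$. $\overline{A}$ denotes the closure of $A\subset\mathcal{G}$ in this topology. Polynomials. For a sequence $\mathbf{a}=(a_1,\ldots,a_e)$ of nonnegative integers put $|\mathbf{a}|=a_1+\cdots+a_e$ and $\mathbf{a}\cdot\mathbb{N}=a_1+2a_2+\cdots+ea_e$; $\binom{|\mathbf{a}|+m}{\mathbf{a},m}=\frac{(|\mathbf{a}|+m)!}{a_1!\cdots a_e!\,m!}$. Define $$g_{d,e}=\frac{1}{d+1}\sum_{\mathbf{a}\cdot\mathbb{N}=d}(-1)^{|\mathbf{a}|}\binom{d+|\mathbf{a}|}{\mathbf{a},d}x_1^{a_1}\cdots x_e^{a_e},\qquad \alpha_{i,j,e}=\sum_{\mathbf{a}\cdot\mathbb{N}=j-i}(-1)^{|\mathbf{a}|}\binom{|\mathbf{a}|+j+2}{\mathbf{a},j+2}x_1^{a_1}\cdots x_e^{a_e}$$ (so $\alpha_{i,j,e}=0$ if $j<i$), and let $a_{d,e}$ be the determinant of the $e\times e$ matrix $$a_{d,e}=\det\big(\alpha_{i,j,e}\ \big|\ 0\le i\le e-1,\ d-1\le j\le d+e-2\big).$$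 *)

theory Defs
  imports
    "HOL-Library.Poly_Mapping"
    "HOL-Computational_Algebra.Polynomial"
    "HOL-Analysis.Abstract_Topology"
    "Jordan_Normal_Form.Determinant"
begin

section \<open>Polynomials in several indeterminates\<close>

text \<open>
  A polynomial over the complex numbers with indeterminates of type \<open>'v\<close> is a finitely supported
  map from exponent vectors to coefficients; \<open>Poly_Mapping.single m c\<close> is the term with
  exponent vector \<open>m\<close> and coefficient \<open>c\<close>.
\<close>

type_synonym 'v mpoly = "('v \<Rightarrow>\<^sub>0 nat) \<Rightarrow>\<^sub>0 complex"

definition polys_in :: "'v set \<Rightarrow> 'v mpoly set" where
  "polys_in V = {p. \<forall>m\<in>Poly_Mapping.keys p. Poly_Mapping.keys m \<subseteq> V}"

definition mp_eval :: "('v \<Rightarrow> complex) \<Rightarrow> 'v mpoly \<Rightarrow> complex" where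
  "mp_eval \<phi> p = (\<Sum>m\<in>Poly_Mapping.keys p.
     Poly_Mapping.lookup p m * (\<Prod>v\<in>Poly_Mapping.keys m. \<phi> v ^ Poly_Mapping.lookup m v))"

text \<open>
  The map is only constrained on the polynomials in the indeterminates \<open>V\<close>, so it encodes exactly
  a homomorphism of complex algebras from that polynomial ring; unitality is the case \<open>c = 1\<close>.
\<close>

definition alg_hom_on :: "'v set \<Rightarrow> ('v mpoly \<Rightarrow> complex) \<Rightarrow> bool" where
  "alg_hom_on V \<psi> \<longleftrightarrow>
     (\<forall>p\<in>polys_in V. \<forall>q\<in>polys_in V. \<psi> (p + q) = \<psi> p + \<psi> q) \<and>
     (\<forall>p\<in>polys_in V. \<forall>q\<in>polys_in V. \<psi> (p * q) = \<psi> p * \<psi> q) \<and>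
     (\<forall>c. \<psi> (Poly_Mapping.single 0 c) = c)"

lemma mp_eval_superset:
  assumes "finite K" "Poly_Mapping.keys p \<subseteq> K"
  shows "mp_eval \<phi> p = (\<Sum>m\<in>K.
    Poly_Mapping.lookup p m * (\<Prod>v\<in>Poly_Mapping.keys m. \<phi> v ^ Poly_Mapping.lookup m v))"
  unfolding mp_eval_def
  by (rule sum.mono_neutral_left) (use assms in \<open>auto simp: in_keys_iff\<close>)

lemma mp_eval_add: "mp_eval \<phi> (p + q) = mp_eval \<phi> p + mp_eval \<phi> q"
proof -
  let ?K = "Poly_Mapping.keys p \<union> Poly_Mapping.keys q"
  have "Poly_Mapping.keys (p + q) \<subseteq> ?K" by (rule Poly_Mapping.keys_add)
  then show ?thesis
    by (subst (1 2 3) mp_eval_superset[where K = ?K])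
       (auto simp: lookup_add algebra_simps sum.distrib)
qed

lemma mp_eval_single:
  "mp_eval \<phi> (Poly_Mapping.single m c) =
     c * (\<Prod>v\<in>Poly_Mapping.keys m. \<phi> v ^ Poly_Mapping.lookup m v)"
  by (subst mp_eval_superset[where K = "{m}"]) (auto simp: lookup_single)

lemma mp_eval_sum: "mp_eval \<phi> (sum f A) = (\<Sum>a\<in>A. mp_eval \<phi> (f a))"
proof -
  have "mp_eval \<phi> 0 = 0" by (simp add: mp_eval_def)
  then show ?thesis
    by (induction A rule: infinite_finite_induct) (simp_all add: mp_eval_add)
qed

lemma monomial_eval_add:
  fixes \<phi> :: "'v \<Rightarrow> complex" and m n :: "'v \<Rightarrow>\<^sub>0 nat"
  shows "(\<Prod>v\<in>Poly_Mapping.keys (m + n). \<phi> v ^ Poly_Mapping.lookup (m + n) v) =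
    (\<Prod>v\<in>Poly_Mapping.keys m. \<phi> v ^ Poly_Mapping.lookup m v) *
    (\<Prod>v\<in>Poly_Mapping.keys n. \<phi> v ^ Poly_Mapping.lookup n v)"
proof -
  let ?K = "Poly_Mapping.keys m \<union> Poly_Mapping.keys n"
  have *: "(\<Prod>v\<in>Poly_Mapping.keys k. \<phi> v ^ Poly_Mapping.lookup k v) =
      (\<Prod>v\<in>?K. \<phi> v ^ Poly_Mapping.lookup k v)"
    if "Poly_Mapping.keys k \<subseteq> ?K" for k :: "'v \<Rightarrow>\<^sub>0 nat"
    by (rule prod.mono_neutral_left) (use that in \<open>auto simp: in_keys_iff\<close>)
  have "Poly_Mapping.keys (m + n) \<subseteq> ?K" by (rule Poly_Mapping.keys_add)
  then show ?thesis
    by (subst (1 2 3) *) (simp_all only: lookup_add power_add prod.distrib Un_upper1 Un_upper2)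
qed

lemma mpoly_expansion:
  fixes p :: "'v mpoly"
  shows "p = (\<Sum>m\<in>Poly_Mapping.keys p. Poly_Mapping.single m (Poly_Mapping.lookup p m))"
  by (rule poly_mapping_eqI)
     (auto simp: lookup_sum lookup_single when_def in_keys_iff)

lemma mp_eval_mult: "mp_eval \<phi> (p * q) = mp_eval \<phi> p * mp_eval \<phi> q"
proof -
  have "p * q = (\<Sum>m\<in>Poly_Mapping.keys p. \<Sum>n\<in>Poly_Mapping.keys q.
      Poly_Mapping.single (m + n) (Poly_Mapping.lookup p m * Poly_Mapping.lookup q n))"
    unfolding mult_single[symmetric] sum_product[symmetric] mpoly_expansion[symmetric] ..
  then have "mp_eval \<phi> (p * q) =
      (\<Sum>m\<in>Poly_Mapping.keys p. \<Sum>n\<in>Poly_Mapping.keys q.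
        (Poly_Mapping.lookup p m * Poly_Mapping.lookup q n) *
        ((\<Prod>v\<in>Poly_Mapping.keys m. \<phi> v ^ Poly_Mapping.lookup m v) *
         (\<Prod>v\<in>Poly_Mapping.keys n. \<phi> v ^ Poly_Mapping.lookup n v)))"
    by (simp only: mp_eval_sum mp_eval_single monomial_eval_add)
  also have "\<dots> = mp_eval \<phi> p * mp_eval \<phi> q"
    unfolding mp_eval_def sum_product by (intro sum.cong refl) (simp only: mult_ac)
  finally show ?thesis .
qed

lemma polys_in_mult:
  assumes "p \<in> polys_in V" "q \<in> polys_in V"
  shows "p * q \<in> polys_in V"
  unfolding polys_in_def
proof (intro CollectI ballI)
  fix m assume "m \<in> Poly_Mapping.keys (p * q)"
  then obtain a b where "m = a + b" "a \<in> Poly_Mapping.keys p" "b \<in> Poly_Mapping.keys q"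
    using Poly_Mapping.keys_mult by blast
  then show "Poly_Mapping.keys m \<subseteq> V"
    using assms Poly_Mapping.keys_add[of a b] unfolding polys_in_def by blast
qed


section \<open>Polynomial automorphisms of the affine plane\<close>

text \<open>
  \<open>\<complex>[X,Y]\<close> is represented as \<open>\<complex>[X][Y]\<close>: the coefficient of \<open>X^i Y^j\<close> in \<open>F\<close> is
  \<open>coeff (coeff F j) i\<close>.
\<close>

type_synonym bpoly = "complex poly poly"
type_synonym pmap = "bpoly \<times> bpoly"

definition bX :: bpoly where "bX = [:[:0, 1:]:]"
definition bY :: bpoly where "bY = [:0, 1:]"

definition bconst :: "complex \<Rightarrow> bpoly" where "bconst c = [:[:c:]:]"

definition poly_in_Y :: "complex poly \<Rightarrow> bpoly" where
  "poly_in_Y P = map_poly (\<lambda>c. [:c:]) P"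

definition bsubst :: "bpoly \<Rightarrow> pmap \<Rightarrow> bpoly" where
  "bsubst F G = poly (map_poly (\<lambda>p. poly (map_poly bconst p) (fst G)) F) (snd G)"

definition pcomp :: "pmap \<Rightarrow> pmap \<Rightarrow> pmap" (infixl "\<circ>\<^sub>p" 70) where
  "F \<circ>\<^sub>p G = (bsubst (fst F) G, bsubst (snd F) G)"

definition pid :: pmap where "pid = (bX, bY)"

definition Aut :: "pmap set" where
  "Aut = {F. \<exists>G. F \<circ>\<^sub>p G = pid \<and> G \<circ>\<^sub>p F = pid}"

definition bdegree :: "bpoly \<Rightarrow> nat" where
  "bdegree F = Max (insert 0 {i + j | i j. coeff (coeff F j) i \<noteq> 0})"

lemma finite_bpoly_support: "finite {i + j | i j. coeff (coeff F j) i \<noteq> 0}"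
  for F :: bpoly
proof -
  have "{i + j | i j. coeff (coeff F j) i \<noteq> 0} \<subseteq>
      (\<Union>j\<in>{..degree F}. (\<lambda>i. i + j) ` {..degree (coeff F j)})"
  proof
    fix n assume "n \<in> {i + j | i j. coeff (coeff F j) i \<noteq> 0}"
    then obtain i j where *: "n = i + j" "coeff (coeff F j) i \<noteq> 0" by blast
    then have "i \<le> degree (coeff F j)" "j \<le> degree F"
      by (auto intro!: le_degree)
    then show "n \<in> (\<Union>j\<in>{..degree F}. (\<lambda>i. i + j) ` {..degree (coeff F j)})"
      using * by auto
  qed
  then show ?thesis by (rule finite_subset) auto
qed

definition pdegree :: "pmap \<Rightarrow> nat" where
  "pdegree F = max (bdegree (fst F)) (bdegree (snd F))"

definition Affine :: "pmap set" where
  "Affine = {F \<in> Aut. pdegree F = 1}"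

definition Triangular :: "pmap set" where
  "Triangular = {(bconst a * bX + poly_in_Y P, bconst b * bY + bconst c) | a b c P.
     a \<noteq> 0 \<and> b \<noteq> 0}"

text \<open>\<open>alt_prod \<alpha> \<tau> k\<close> is the product \<open>\<alpha> 0 \<tau> 1 \<alpha> 1 \<dots> \<tau> k \<alpha> k\<close>.\<close>

primrec alt_prod :: "(nat \<Rightarrow> pmap) \<Rightarrow> (nat \<Rightarrow> pmap) \<Rightarrow> nat \<Rightarrow> pmap" where
  "alt_prod \<alpha> \<tau> 0 = \<alpha> 0"
| "alt_prod \<alpha> \<tau> (Suc k) = alt_prod \<alpha> \<tau> k \<circ>\<^sub>p \<tau> (Suc k) \<circ>\<^sub>p \<alpha> (Suc k)"

definition has_polydegree :: "pmap \<Rightarrow> nat list \<Rightarrow> bool" where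
  "has_polydegree \<theta> ds \<longleftrightarrow> (\<exists>k \<alpha> \<tau>.
     (\<forall>i\<le>k. \<alpha> i \<in> Affine) \<and>
     (\<forall>i\<in>{1..k}. \<tau> i \<in> Triangular - Affine) \<and>
     (\<forall>i. 0 < i \<and> i < k \<longrightarrow> \<alpha> i \<notin> Triangular) \<and>
     \<theta> = alt_prod \<alpha> \<tau> k \<and>
     ds = map (\<lambda>i. pdegree (\<tau> i)) [1..<k+1])"

definition Aut_polydeg :: "nat list \<Rightarrow> pmap set" where
  "Aut_polydeg ds = {\<theta> \<in> Aut. has_polydegree \<theta> ds}"


section \<open>The ind-variety topology\<close>

definition Aut_le :: "nat \<Rightarrow> pmap set" where
  "Aut_le n = {F \<in> Aut. pdegree F \<le> n}"

text \<open>
  Coordinates on the space of pairs of polynomials: \<open>Inl (i, j)\<close> and \<open>Inr (i, j)\<close> index the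
  coefficient of \<open>X^i Y^j\<close> in the first and in the second component.
\<close>

type_synonym coord = "nat \<times> nat + nat \<times> nat"

definition pcoeffs :: "pmap \<Rightarrow> coord \<Rightarrow> complex" where
  "pcoeffs F = case_sum (\<lambda>(i, j). coeff (coeff (fst F) j) i) (\<lambda>(i, j). coeff (coeff (snd F) j) i)"

definition coords_le :: "nat \<Rightarrow> coord set" where
  "coords_le n = {(i, j). i + j \<le> n} <+> {(i, j). i + j \<le> n}"

definition zariski_closed_le :: "nat \<Rightarrow> pmap set \<Rightarrow> bool" where
  "zariski_closed_le n Z \<longleftrightarrow> (\<exists>S \<subseteq> polys_in (coords_le n).
     Z = {F \<in> Aut_le n. \<forall>p\<in>S. mp_eval (pcoeffs F) p = 0})"

definition ind_closed :: "pmap set \<Rightarrow> bool" where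
  "ind_closed C \<longleftrightarrow> C \<subseteq> Aut \<and> (\<forall>n. zariski_closed_le n (C \<inter> Aut_le n))"

definition ind_topology :: "pmap topology" where
  "ind_topology = topology (\<lambda>U. U \<subseteq> Aut \<and> ind_closed (Aut - U))"

lemma zariski_closed_le_Un:
  assumes "zariski_closed_le n Z" "zariski_closed_le n W"
  shows "zariski_closed_le n (Z \<union> W)"
proof -
  obtain S T where ST: "S \<subseteq> polys_in (coords_le n)" "T \<subseteq> polys_in (coords_le n)"
    and Z: "Z = {F \<in> Aut_le n. \<forall>p\<in>S. mp_eval (pcoeffs F) p = 0}"
    and W: "W = {F \<in> Aut_le n. \<forall>p\<in>T. mp_eval (pcoeffs F) p = 0}"
    using assms unfolding zariski_closed_le_def by auto
  define R where "R = {p * q | p q. p \<in> S \<and> q \<in> T}"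
  have "R \<subseteq> polys_in (coords_le n)"
    using ST polys_in_mult unfolding R_def by blast
  moreover have "Z \<union> W = {F \<in> Aut_le n. \<forall>p\<in>R. mp_eval (pcoeffs F) p = 0}"
  proof (intro equalityI subsetI)
    fix F assume "F \<in> Z \<union> W"
    then show "F \<in> {F \<in> Aut_le n. \<forall>p\<in>R. mp_eval (pcoeffs F) p = 0}"
      unfolding Z W R_def by (auto simp: mp_eval_mult)
  next
    fix F assume F: "F \<in> {F \<in> Aut_le n. \<forall>p\<in>R. mp_eval (pcoeffs F) p = 0}"
    show "F \<in> Z \<union> W"
    proof (rule ccontr)
      assume "F \<notin> Z \<union> W"
      then obtain p q where pq: "p \<in> S" "mp_eval (pcoeffs F) p \<noteq> 0"
        "q \<in> T" "mp_eval (pcoeffs F) q \<noteq> 0"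
        using F unfolding Z W by blast
      then have "p * q \<in> R" unfolding R_def by blast
      then have "mp_eval (pcoeffs F) (p * q) = 0" using F by blast
      then show False using pq by (simp add: mp_eval_mult)
    qed
  qed
  ultimately show ?thesis unfolding zariski_closed_le_def by blast
qed

lemma zariski_closed_le_Inter:
  assumes "\<And>Z. Z \<in> \<Z> \<Longrightarrow> zariski_closed_le n Z"
  shows "zariski_closed_le n (Aut_le n \<inter> \<Inter>\<Z>)"
proof -
  have "\<forall>Z\<in>\<Z>. \<exists>S. S \<subseteq> polys_in (coords_le n) \<and>
      Z = {F \<in> Aut_le n. \<forall>p\<in>S. mp_eval (pcoeffs F) p = 0}"
    using assms unfolding zariski_closed_le_def by simp
  then obtain S where S: "\<forall>Z\<in>\<Z>. S Z \<subseteq> polys_in (coords_le n) \<and>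
      Z = {F \<in> Aut_le n. \<forall>p\<in>S Z. mp_eval (pcoeffs F) p = 0}"
    by (rule bchoice[THEN exE])
  have mem: "F \<in> Z \<longleftrightarrow> F \<in> Aut_le n \<and> (\<forall>p\<in>S Z. mp_eval (pcoeffs F) p = 0)"
    if "Z \<in> \<Z>" for F Z
    using S that by blast
  have "Aut_le n \<inter> \<Inter>\<Z> = {F \<in> Aut_le n. \<forall>p\<in>(\<Union>Z\<in>\<Z>. S Z). mp_eval (pcoeffs F) p = 0}"
    by (intro equalityI subsetI) (simp_all add: mem)
  moreover have "(\<Union>Z\<in>\<Z>. S Z) \<subseteq> polys_in (coords_le n)" using S by blast
  ultimately show ?thesis unfolding zariski_closed_le_def by blast
qed

lemma ind_closed_Un:
  assumes "ind_closed C" "ind_closed D"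
  shows "ind_closed (C \<union> D)"
  using assms unfolding ind_closed_def
  by (auto simp: Int_Un_distrib2 intro: zariski_closed_le_Un)

lemma ind_closed_Inter:
  assumes "\<And>C. C \<in> \<C> \<Longrightarrow> ind_closed C"
  shows "ind_closed (Aut \<inter> \<Inter>\<C>)"
  unfolding ind_closed_def
proof (intro conjI allI)
  fix n
  have "zariski_closed_le n (Aut_le n \<inter> \<Inter>((\<lambda>C. C \<inter> Aut_le n) ` \<C>))"
    by (rule zariski_closed_le_Inter) (use assms in \<open>auto simp: ind_closed_def\<close>)
  moreover have "Aut_le n \<inter> \<Inter>((\<lambda>C. C \<inter> Aut_le n) ` \<C>) = Aut \<inter> \<Inter>\<C> \<inter> Aut_le n"
    by (auto simp: Aut_le_def)
  ultimately show "zariski_closed_le n (Aut \<inter> \<Inter>\<C> \<inter> Aut_le n)" by simp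
qed auto

lemma istopology_ind: "istopology (\<lambda>U. U \<subseteq> Aut \<and> ind_closed (Aut - U))"
  unfolding istopology_def
proof (intro conjI allI impI)
  fix S T assume "S \<subseteq> Aut \<and> ind_closed (Aut - S)" "T \<subseteq> Aut \<and> ind_closed (Aut - T)"
  then show "ind_closed (Aut - S \<inter> T)"
    by (simp add: Diff_Int ind_closed_Un)
next
  fix \<K> :: "pmap set set"
  assume K: "\<forall>K\<in>\<K>. K \<subseteq> Aut \<and> ind_closed (Aut - K)"
  have "ind_closed (Aut \<inter> \<Inter>((\<lambda>K. Aut - K) ` \<K>))"
    by (rule ind_closed_Inter) (use K in auto)
  moreover have "Aut \<inter> \<Inter>((\<lambda>K. Aut - K) ` \<K>) = Aut - \<Union>\<K>" by auto
  ultimately show "ind_closed (Aut - \<Union>\<K>)" by simp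
qed auto

lemma openin_ind_topology: "openin ind_topology U \<longleftrightarrow> U \<subseteq> Aut \<and> ind_closed (Aut - U)"
  unfolding ind_topology_def using istopology_ind by simp

lemma topspace_ind_topology: "topspace ind_topology = Aut"
proof -
  have "ind_closed {}"
    unfolding ind_closed_def zariski_closed_le_def
  proof (intro conjI allI exI)
    show "{1} \<subseteq> polys_in (coords_le n)" for n by (simp add: polys_in_def)
    show "{} \<inter> Aut_le n = {F \<in> Aut_le n. \<forall>p\<in>{1}. mp_eval (pcoeffs F) p = 0}" for n
      by (simp add: mp_eval_def)
  qed simp
  then have "openin ind_topology Aut" by (simp add: openin_ind_topology)
  then show ?thesis
    by (metis openin_ind_topology openin_topspace openin_subset subset_antisym)
qed

lemma closedin_ind_topology: "closedin ind_topology C \<longleftrightarrow> ind_closed C"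
  unfolding closedin_def topspace_ind_topology openin_ind_topology
  by (auto simp: ind_closed_def double_diff)


section \<open>The polynomials $g_{d,e}$, $\alpha_{i,j,e}$ and $a_{d,e}$\<close>

text \<open>
  A sequence \<open>(a_1, \<dots>, a_e)\<close> is a finitely supported function with support in \<open>{1..e}\<close>, hence it
  is also the exponent vector of \<open>x_1^{a_1} \<dots> x_e^{a_e}\<close>.
\<close>

definition expseqs :: "nat \<Rightarrow> (nat \<Rightarrow>\<^sub>0 nat) set" where
  "expseqs e = {a. Poly_Mapping.keys a \<subseteq> {1..e}}"

definition esize :: "nat \<Rightarrow> (nat \<Rightarrow>\<^sub>0 nat) \<Rightarrow> nat" where
  "esize e a = (\<Sum>k=1..e. Poly_Mapping.lookup a k)"

definition eweight :: "nat \<Rightarrow> (nat \<Rightarrow>\<^sub>0 nat) \<Rightarrow> nat" where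
  "eweight e a = (\<Sum>k=1..e. k * Poly_Mapping.lookup a k)"

definition multinom :: "nat \<Rightarrow> (nat \<Rightarrow>\<^sub>0 nat) \<Rightarrow> nat \<Rightarrow> complex" where
  "multinom e a m =
     fact (esize e a + m) / ((\<Prod>k=1..e. fact (Poly_Mapping.lookup a k)) * fact m)"

lemma finite_expseqs_weight: "finite {a \<in> expseqs e. eweight e a + i = n}"
proof -
  let ?A = "{a \<in> expseqs e. eweight e a + i = n}"
  have inj: "inj_on Poly_Mapping.lookup ?A"
    by (rule inj_onI) (rule poly_mapping_eqI, simp)
  have "Poly_Mapping.lookup a k \<le> n" if "a \<in> ?A" "k \<in> {1..e}" for a k
  proof -
    have "Poly_Mapping.lookup a k \<le> k * Poly_Mapping.lookup a k" using that by simp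
    also have "\<dots> \<le> eweight e a"
      unfolding eweight_def by (rule member_le_sum) (use that in auto)
    also have "\<dots> \<le> n" using that by simp
    finally show ?thesis .
  qed
  then have "Poly_Mapping.lookup ` ?A \<subseteq>
      {f. \<forall>k. (k \<in> {1..e} \<longrightarrow> f k \<in> {..n}) \<and> (k \<notin> {1..e} \<longrightarrow> f k = 0)}"
    by (auto simp: expseqs_def in_keys_iff subset_iff)
  moreover have "finite \<dots>" by (rule finite_set_of_finite_funs) auto
  ultimately show ?thesis using inj finite_imageD finite_subset by blast
qed

definition gpoly :: "nat \<Rightarrow> nat \<Rightarrow> nat mpoly" where
  "gpoly d e = (\<Sum>a\<in>{a \<in> expseqs e. eweight e a = d}.
     Poly_Mapping.single a (1 / of_nat (d + 1) * ((-1) ^ esize e a * multinom e a d)))"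

text \<open>The condition on the weight reads \<open>j - i\<close> as an integer, so the sum is empty if \<open>j < i\<close>.\<close>

definition alpha :: "nat \<Rightarrow> nat \<Rightarrow> nat \<Rightarrow> nat mpoly" where
  "alpha i j e = (\<Sum>a\<in>{a \<in> expseqs e. eweight e a + i = j}.
     Poly_Mapping.single a ((-1) ^ esize e a * multinom e a (j + 2)))"

text \<open>Column \<open>l\<close> of the matrix is the one with index \<open>j = d - 1 + l\<close>; \<open>d\<close> is positive.\<close>

definition apoly :: "nat \<Rightarrow> nat \<Rightarrow> nat mpoly" where
  "apoly d e = det (mat e e (\<lambda>(i, l). alpha i (d - 1 + l) e))"

end

theory Submission
  imports Defs "HOL-Computational_Algebra.Polynomial_FPS"
begin

text \<open>
  Put \<open>p = Y + x_1 Y\<^sup>2 + \<dots> + x_e Y^(e+1)\<close>. By Lagrange inversion the coefficient of \<open>Z^(j+1)\<close> in the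
  compositional inverse of \<open>p\<close> is \<open>g_{j,e}\<close>, and up to sign \<open>a_{d,e}\<close> is the Jacobian of
  \<open>g_{d,e}, \<dots>, g_{d+e-1,e}\<close>. Up to affine maps an automorphism of polydegree \<open>(d+e)\<close> is
  \<open>(X + R(Y), Y)\<close> with \<open>deg R = n = d + e\<close>. The Jacobian condition allows to solve, by the chord
  method over polynomials in \<open>s\<close>, for a curve \<open>x(s)\<close> through the point given by \<open>\<psi>\<close> such that
  \<open>g_{d+l,e}(x(s)) = - \<rho> R_{d+l+1} s^(e-1-l) + O(s^e)\<close> for \<open>l < e\<close>; at \<open>s = 0\<close> this is possible
  because of the conditions on \<open>\<psi>(g_{d+i,e})\<close>. Let \<open>Q_s\<close> be the truncation at degree \<open>d\<close> of the
  inverse of \<open>p_s\<close>, plus the terms \<open>\<rho> R_j s^(n-j) Z^j\<close> for \<open>j \<le> d\<close>. With \<open>u = \<rho> s^n X + p_s(s Y)\<close> and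
  \<open>v = Q_s(u) - s Y\<close>, the map \<open>(v / (\<rho> s^n), u / s)\<close> has polydegree \<open>(d, e+1)\<close> and tends to
  \<open>(X + R(Y), Y)\<close> as \<open>s\<close> tends to \<open>0\<close>. A coefficientwise limit of automorphisms of bounded degree
  lies in the closure for the ind-topology.
\<close>

section \<open>Negative powers and Lagrange inversion\<close>

text \<open>This is \<open>p / Y\<close> as a power series, so that negative powers exist; the
  constant term 1 plays the part of x_0.\<close>

definition cseries :: "nat \<Rightarrow> (nat \<Rightarrow> complex) \<Rightarrow> complex fps" where
  "cseries e x = Abs_fps (\<lambda>n. if n = 0 then 1 else if n \<le> e then x n else 0)"

text \<open>The contribution of the exponent vector \<open>a\<close> to the power of
  \<open>cseries\<close> with exponent \<open>- (m + 1)\<close>; \<open>m\<close> is the extra lower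
  entry of the multinomial coefficient.\<close>

definition mterm :: "nat \<Rightarrow> (nat \<Rightarrow> complex) \<Rightarrow> nat \<Rightarrow> (nat \<Rightarrow>\<^sub>0 nat) \<Rightarrow> complex" where
  "mterm e x m a =
     (-1) ^ esize e a * multinom e a m * (\<Prod>k=1..e. x k ^ Poly_Mapping.lookup a k)"

lemma cseries_nth:
  "fps_nth (cseries e x) n = (if n = 0 then 1 else if n \<le> e then x n else 0)"
  by (simp add: cseries_def)

lemma inverse_mult_cseries: "inverse (cseries e x) * cseries e x = 1"
  by (rule inverse_mult_eq_1) (simp add: cseries_nth)

section \<open>Exponent vectors with one entry raised or lowered\<close>

lemma lookup_decr:
  "Poly_Mapping.lookup (a - Poly_Mapping.single i (Suc 0)) k =
     (if k = i then Poly_Mapping.lookup a k - 1 else Poly_Mapping.lookup a k)"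
  by (simp add: lookup_minus lookup_single)

lemma esize_incr:
  assumes "i \<in> {1..e}"
  shows "esize e (a + Poly_Mapping.single i (Suc 0)) = Suc (esize e a)"
  using assms by (simp add: esize_def lookup_add lookup_single when_def sum.distrib)

lemma eweight_incr:
  assumes "i \<in> {1..e}"
  shows "eweight e (a + Poly_Mapping.single i (Suc 0)) = eweight e a + i"
proof -
  have "(\<Sum>k=1..e. k * (if i = k then Suc 0 else 0)) = i"
    using assms by (simp add: if_distrib[of "\<lambda>x. _ * x"] cong: if_cong)
  then show ?thesis
    by (simp add: eweight_def lookup_add lookup_single when_def algebra_simps sum.distrib)
qed

lemma decr_incr:
  assumes "Poly_Mapping.lookup a i \<noteq> (0::nat)"
  shows "a - Poly_Mapping.single i (Suc 0) + Poly_Mapping.single i (Suc 0) = a"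
proof (rule poly_mapping_eqI)
  fix k
  show "Poly_Mapping.lookup (a - Poly_Mapping.single i (Suc 0) + Poly_Mapping.single i (Suc 0)) k =
      Poly_Mapping.lookup a k"
    unfolding lookup_add lookup_minus lookup_single when_def using assms by (cases "k = i") simp_all
qed

text \<open>Removing one factor \<open>x i\<close> costs a sign and the ratio
  \<open>a_i / (|a| + m)\<close> of multinomial coefficients. Summed over \<open>i\<close> these
  ratios give \<open>|a| / (|a| + m)\<close>, which drives the recursion for
  \<open>mterm\<close>.\<close>

lemma mterm_decr:
  assumes i: "i \<in> {1..e}" and ai: "Poly_Mapping.lookup a i \<noteq> 0"
  shows "x i * mterm e x m (a - Poly_Mapping.single i (Suc 0)) =
    - (of_nat (Poly_Mapping.lookup a i) / of_nat (esize e a + m)) * mterm e x m a"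
proof -
  define b where "b = a - Poly_Mapping.single i (Suc 0)"
  have a: "a = b + Poly_Mapping.single i (Suc 0)"
    unfolding b_def using decr_incr[OF ai] by simp
  have l: "Poly_Mapping.lookup a k = (if k = i then Suc (Poly_Mapping.lookup b k) else Poly_Mapping.lookup b k)" for k
    by (auto simp: a lookup_add lookup_single)
  have s: "esize e a = Suc (esize e b)"
    unfolding a by (rule esize_incr[OF i])
  have split: "(\<Prod>k=1..e. F k) = F i * (\<Prod>k\<in>{1..e} - {i}. F k)" for F :: "nat \<Rightarrow> complex"
    using i by (intro prod.remove) auto
  have f: "(\<Prod>k=1..e. fact (Poly_Mapping.lookup a k) :: complex) =
      of_nat (Suc (Poly_Mapping.lookup b i)) * (\<Prod>k=1..e. fact (Poly_Mapping.lookup b k))"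
    unfolding split by (simp add: l del: of_nat_Suc)
  have x: "(\<Prod>k=1..e. x k ^ Poly_Mapping.lookup a k) =
      x i * (\<Prod>k=1..e. x k ^ Poly_Mapping.lookup b k)"
    unfolding split by (simp add: l)
  have nz: "(\<Prod>k=1..e. fact (Poly_Mapping.lookup b k) :: complex) \<noteq> 0" by simp
  have nz2: "of_nat (Suc (esize e b + m)) \<noteq> (0::complex)"
    "of_nat (Suc (Poly_Mapping.lookup b i)) \<noteq> (0::complex)" by (simp_all only: of_nat_eq_0_iff)
  have quot: "u \<noteq> 0 \<Longrightarrow> v \<noteq> 0 \<Longrightarrow> q / (r * t) = u / v * (v * q / (u * r * t))" for u v q r t :: complex
    by simp
  have mn2: "multinom e b m = of_nat (Suc (Poly_Mapping.lookup b i)) / of_nat (Suc (esize e b + m)) * multinom e a m"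
    unfolding multinom_def f s add_Suc fact_Suc of_nat_mult of_nat_id
    by (rule quot[OF nz2(2) nz2(1)])
  have li: "Poly_Mapping.lookup a i = Suc (Poly_Mapping.lookup b i)" by (simp add: l)
  have "esize e a + m = Suc (esize e b + m)" using s by simp
  then have "multinom e b m = of_nat (Poly_Mapping.lookup a i) / of_nat (esize e a + m) * multinom e a m"
    using mn2 li by simp
  moreover have "(-1) ^ esize e a = - ((-1) ^ esize e b :: complex)" using s by simp
  ultimately show ?thesis
    unfolding b_def[symmetric] mterm_def x by (simp add: mult_ac del: of_nat_add)
qed

lemma esize_eq_0:
  assumes "a \<in> expseqs e" "esize e a = 0"
  shows "a = 0"
proof (rule poly_mapping_eqI)
  fix k
  show "Poly_Mapping.lookup a k = Poly_Mapping.lookup 0 k"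
  proof (cases "k \<in> {1..e}")
    case True
    then show ?thesis using assms(2) unfolding esize_def by (subst (asm) sum_eq_0_iff) simp_all
  next
    case False
    then show ?thesis using assms(1) by (auto simp: expseqs_def in_keys_iff)
  qed
qed

text \<open>Pascal's recursion for multinomial coefficients: it says that multiplication by the series
  lowers the exponent of the inverse power by one.\<close>

lemma mterm_pascal:
  assumes a: "a \<in> expseqs e"
  shows "mterm e x m a + (\<Sum>i=1..e. if Poly_Mapping.lookup a i = 0 then 0
           else x i * mterm e x m (a - Poly_Mapping.single i (Suc 0))) =
    (if m = 0 then if a = 0 then 1 else 0 else mterm e x (m - 1) a)"
proof -
  have "(\<Sum>i=1..e. if Poly_Mapping.lookup a i = 0 then 0
           else x i * mterm e x m (a - Poly_Mapping.single i (Suc 0))) =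
        (\<Sum>i=1..e. - (of_nat (Poly_Mapping.lookup a i) / of_nat (esize e a + m)) * mterm e x m a)"
    by (intro sum.cong refl) (auto simp: mterm_decr[simplified])
  also have "\<dots> = - (of_nat (esize e a) / of_nat (esize e a + m)) * mterm e x m a"
    unfolding esize_def of_nat_sum sum_distrib_right[symmetric] sum_negf sum_divide_distrib[symmetric] ..
  finally have *: "(\<Sum>i=1..e. if Poly_Mapping.lookup a i = 0 then 0
           else x i * mterm e x m (a - Poly_Mapping.single i (Suc 0))) = \<dots>" .
  show ?thesis
  proof (cases m)
    \<comment> \<open>The ratio \<open>|a| / (|a| + m)\<close> is 1 for nonzero \<open>a\<close>, so
      the terms cancel; for \<open>a = 0\<close> it is 0 / 0 = 0 and the constant term 1
      remains.\<close>
    case 0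
    show ?thesis
    proof (cases "a = 0")
      case True
      then show ?thesis using 0 * by (simp add: mterm_def esize_def multinom_def)
    next
      case False
      then have "esize e a \<noteq> 0" using esize_eq_0 a by blast
      then show ?thesis using 0 * False by simp
    qed
  next
    case (Suc m')
    have nz: "of_nat (esize e a + Suc m') \<noteq> (0::complex)" by (simp only: of_nat_eq_0_iff)
    have nz2: "of_nat (Suc m') \<noteq> (0::complex)" by (simp only: of_nat_eq_0_iff)
    have nz3: "(\<Prod>k=1..e. fact (Poly_Mapping.lookup a k) :: complex) \<noteq> 0" by simp
    have "of_nat (esize e a + Suc m') * multinom e a m' = of_nat (Suc m') * multinom e a (Suc m')"
      unfolding multinom_def using nz2 nz3 by (simp add: field_simps del: of_nat_Suc of_nat_add)
    then have "of_nat (esize e a + Suc m') * mterm e x m' a = of_nat (Suc m') * mterm e x (Suc m') a"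
      unfolding mterm_def by (simp add: ac_simps del: of_nat_Suc of_nat_add)
    then have e: "mterm e x m' a = of_nat (Suc m') / of_nat (esize e a + Suc m') * mterm e x (Suc m') a"
      using nz by (simp add: field_simps del: of_nat_Suc of_nat_add)
    have "1 - of_nat (esize e a) / of_nat (esize e a + Suc m') =
       (of_nat (Suc m') / of_nat (esize e a + Suc m') :: complex)"
      using nz by (simp add: divide_simps del: of_nat_Suc) (simp add: algebra_simps)
    then have "mterm e x (Suc m') a + - (of_nat (esize e a) / of_nat (esize e a + Suc m')) * mterm e x (Suc m') a =
        mterm e x m' a"
      unfolding e by (metis diff_conv_add_uminus mult.left_neutral mult_minus_left ring_class.ring_distribs(2))
    then show ?thesis using * Suc by simp
  qed
qed

text \<open>Division by x_i is a bijection from the monomials of weight \<open>w\<close> that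
  contain x_i to all monomials of weight \<open>w - i\<close>.\<close>

lemma sum_weight_shift:
  fixes F :: "(nat \<Rightarrow>\<^sub>0 nat) \<Rightarrow> complex"
  assumes i: "i \<in> {1..e}" and w: "i \<le> w"
  shows "(\<Sum>a | a \<in> expseqs e \<and> eweight e a = w - i. F a) =
    (\<Sum>a | a \<in> expseqs e \<and> eweight e a = w.
       if Poly_Mapping.lookup a i = 0 then 0 else F (a - Poly_Mapping.single i (Suc 0)))"
proof -
  have fin: "finite {a. a \<in> expseqs e \<and> eweight e a = w}"
    using finite_expseqs_weight[of e 0 w] by simp
  have "(\<Sum>a | a \<in> expseqs e \<and> eweight e a = w.
       if Poly_Mapping.lookup a i = 0 then 0 else F (a - Poly_Mapping.single i (Suc 0))) =
     (\<Sum>a | a \<in> expseqs e \<and> eweight e a = w \<and> Poly_Mapping.lookup a i \<noteq> 0. F (a - Poly_Mapping.single i (Suc 0)))"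
    by (rule sum.mono_neutral_cong_right) (use fin in auto)
  also have "\<dots> = (\<Sum>a | a \<in> expseqs e \<and> eweight e a = w - i. F a)"
  proof (rule sum.reindex_bij_witness[where i = "\<lambda>a. a + Poly_Mapping.single i (Suc 0)" and j = "\<lambda>a. a - Poly_Mapping.single i (Suc 0)"])
    fix a assume a: "a \<in> {a. a \<in> expseqs e \<and> eweight e a = w \<and> Poly_Mapping.lookup a i \<noteq> 0}"
    then show d: "a - Poly_Mapping.single i (Suc 0) + Poly_Mapping.single i (Suc 0) = a"
      using decr_incr[of a i] by simp
    have "eweight e (a - Poly_Mapping.single i (Suc 0)) + i = w"
      using eweight_incr[OF i, of "a - Poly_Mapping.single i (Suc 0)"] a unfolding d by simp
    moreover have "a - Poly_Mapping.single i (Suc 0) \<in> expseqs e"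
      using a by (force simp: expseqs_def in_keys_iff lookup_decr subset_iff)
    ultimately show "a - Poly_Mapping.single i (Suc 0) \<in> {a. a \<in> expseqs e \<and> eweight e a = w - i}"
      by auto
  next
    fix a assume a: "a \<in> {a. a \<in> expseqs e \<and> eweight e a = w - i}"
    have "a + Poly_Mapping.single i (Suc 0) \<in> expseqs e"
      using a i by (auto simp: expseqs_def in_keys_iff lookup_add lookup_single subset_iff when_def split: if_splits)
    then show "a + Poly_Mapping.single i (Suc 0) \<in> {a. a \<in> expseqs e \<and> eweight e a = w \<and> Poly_Mapping.lookup a i \<noteq> 0}"
      using a w eweight_incr[OF i, of a] by (auto simp: lookup_add)
  qed auto
  finally show ?thesis ..
qed

lemma eweight_ge:
  assumes "i \<in> {1..e}" "Poly_Mapping.lookup a i \<noteq> 0"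
  shows "i \<le> eweight e a"
proof -
  have "i \<le> i * Poly_Mapping.lookup a i" using assms by simp
  also have "\<dots> \<le> eweight e a"
    unfolding eweight_def by (rule member_le_sum) (use assms in auto)
  finally show ?thesis .
qed

text \<open>The multinomial theorem for negative exponents. By Pascal's recursion the claimed
  expansions satisfy \<open>cseries * S m = S (m - 1)\<close>, with 1 on the right for
  \<open>m = 0\<close>; dividing by \<open>cseries\<close> repeatedly gives the powers of its
  inverse.\<close>

lemma inverse_cseries_power_nth:
  "fps_nth (inverse (cseries e x) ^ Suc m) w =
     (\<Sum>a | a \<in> expseqs e \<and> eweight e a = w. mterm e x m a)"
proof -
  define S where "S m = Abs_fps (\<lambda>w. \<Sum>a | a \<in> expseqs e \<and> eweight e a = w. mterm e x m a)" for m
  have step: "cseries e x * S m = (if m = 0 then 1 else S (m - 1))" for m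
  proof (rule fps_ext)
    fix w
    let ?W = "{a. a \<in> expseqs e \<and> eweight e a = w}"
    have fin: "finite ?W" using finite_expseqs_weight[of e 0 w] by simp
    let ?t = "\<lambda>a i. if Poly_Mapping.lookup a i = 0 then 0
           else x i * mterm e x m (a - Poly_Mapping.single i (Suc 0))"
    have "(\<Sum>i=1..w. fps_nth (cseries e x) i * fps_nth (S m) (w - i)) = (\<Sum>i\<in>{1..w}\<inter>{1..e}. fps_nth (cseries e x) i * fps_nth (S m) (w - i))"
      by (rule sum.mono_neutral_right) (auto simp: cseries_nth)
    also have "\<dots> = (\<Sum>i\<in>{1..w}\<inter>{1..e}. \<Sum>a\<in>?W. ?t a i)"
    proof (rule sum.cong[OF refl])
      fix i assume i: "i \<in> {1..w} \<inter> {1..e}"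
      have "fps_nth (cseries e x) i * fps_nth (S m) (w - i) =
          (\<Sum>a | a \<in> expseqs e \<and> eweight e a = w - i. x i * mterm e x m a)"
        using i by (auto simp: cseries_nth S_def sum_distrib_left)
      also have "\<dots> = (\<Sum>a\<in>?W. ?t a i)"
        using i by (subst sum_weight_shift) auto
      finally show "fps_nth (cseries e x) i * fps_nth (S m) (w - i) = (\<Sum>a\<in>?W. ?t a i)" .
    qed
    \<comment> \<open>Indices \<open>i > w\<close> may be added, because a vector of weight
      \<open>w\<close> has entry 0 there.\<close>
    also have "\<dots> = (\<Sum>i=1..e. \<Sum>a\<in>?W. ?t a i)"
    proof (rule sum.mono_neutral_left)
      show "\<forall>i\<in>{1..e} - {1..w} \<inter> {1..e}. (\<Sum>a\<in>?W. ?t a i) = 0"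
      proof (intro ballI sum.neutral)
        fix i a assume i: "i \<in> {1..e} - {1..w} \<inter> {1..e}" and a: "a \<in> ?W"
        then have "Poly_Mapping.lookup a i = 0"
          using eweight_ge[of i e a] by auto
        then show "?t a i = 0" by simp
      qed
    qed auto
    also have "\<dots> = (\<Sum>a\<in>?W. \<Sum>i=1..e. ?t a i)" by (rule sum.swap)
    finally have "fps_nth (cseries e x * S m) w = (\<Sum>a\<in>?W. mterm e x m a + (\<Sum>i=1..e. ?t a i))"
      by (simp add: fps_mult_nth sum.atLeast_Suc_atMost S_def cseries_nth sum.distrib)
    also have "\<dots> = (\<Sum>a\<in>?W. (if m = 0 then if a = 0 then 1 else 0 else mterm e x (m - 1) a))"
      by (intro sum.cong refl mterm_pascal) auto
    also have "\<dots> = fps_nth (if m = 0 then 1 else S (m - 1)) w"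
    proof (cases "m = 0")
      case True
      have "(0::nat \<Rightarrow>\<^sub>0 nat) \<in> ?W \<longleftrightarrow> w = 0" by (auto simp: expseqs_def eweight_def)
      then show ?thesis using True fin by (simp add: sum.delta)
    qed (simp add: S_def)
    finally show "fps_nth (cseries e x * S m) w = fps_nth (if m = 0 then 1 else S (m - 1)) w" .
  qed
  have inv: "inverse (cseries e x) * (cseries e x * G) = G" for G
    unfolding mult.assoc[symmetric] inverse_mult_cseries by simp
  have "inverse (cseries e x) ^ Suc m = S m" for m
  proof (induction m)
    case 0
    then show ?case using inv[of "S 0"] step[of 0] by simp
  next
    case (Suc m)
    then show ?case using inv[of "S (Suc m)"] step[of "Suc m"] by simp
  qed
  then show ?thesis by (simp add: S_def)
qed

section \<open>Lagrange inversion by residues\<close>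

lemma fps_deriv_inverse_power:
  fixes f :: "complex fps"
  assumes "fps_nth f 0 \<noteq> 0"
  shows "fps_deriv (inverse f ^ r) = - (of_nat r * (fps_deriv f * inverse f ^ Suc r))"
proof (cases r)
  case (Suc k)
  have "fps_deriv (inverse f) = - fps_deriv f * inverse f ^ 2"
    using assms by (rule fps_inverse_deriv)
  then show ?thesis
    unfolding Suc fps_deriv_power by (simp add: power2_eq_square mult_ac fps_of_nat del: of_nat_Suc)
qed simp

text \<open>A residue written without negative exponents: with \<open>p = fps_X * f\<close> it is
  the coefficient of X^(-1) in p' / p^(r+1). For \<open>r > 0\<close> it vanishes because this
  quotient is the derivative of - p^(-r) / r.\<close>

lemma fps_nth_deriv_X_mult_inverse_power:
  fixes f :: "complex fps"
  assumes f0: "fps_nth f 0 \<noteq> 0"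
  shows "fps_nth (fps_deriv (fps_X * f) * inverse f ^ Suc r) r = (if r = 0 then 1 else 0)"
proof -
  have inv: "f * inverse f = 1" using f0 by (rule inverse_mult_eq_1')
  have eq: "fps_deriv (fps_X * f) * inverse f ^ Suc r =
      inverse f ^ r + fps_X * (fps_deriv f * inverse f ^ Suc r)"
    using inv by (simp add: algebra_simps)
  show ?thesis
  proof (cases r)
    case 0
    then show ?thesis unfolding eq by simp
  next
    case (Suc k)
    \<comment> \<open>The coefficient of index \<open>k = r - 1\<close> of the derivative is
      computed termwise and by the chain rule.\<close>
    have "of_nat r * fps_nth (inverse f ^ r) r =
        fps_nth (fps_deriv (inverse f ^ r)) k"
      unfolding fps_deriv_nth Suc by (simp only: Suc_eq_plus1)
    also have "\<dots> = - (of_nat r * fps_nth (fps_deriv f * inverse f ^ Suc r) k)"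
      unfolding fps_deriv_inverse_power[OF f0] fps_of_nat[symmetric] by (simp del: fps_of_nat)
    finally have "of_nat r * (fps_nth (inverse f ^ r) r + fps_nth (fps_deriv f * inverse f ^ Suc r) k) = 0"
      by (simp add: algebra_simps)
    moreover have "of_nat r \<noteq> (0::complex)" unfolding Suc by (simp only: of_nat_eq_0_iff)
    ultimately have "fps_nth (inverse f ^ r) r + fps_nth (fps_deriv f * inverse f ^ Suc r) k = 0"
      by (metis mult_eq_0_iff)
    then show ?thesis unfolding eq using Suc by simp
  qed
qed

lemma fps_X_mult_power_nth_eq_0:
  fixes f :: "complex fps"
  assumes "k < i"
  shows "fps_nth ((fps_X * f) ^ i) k = 0"
  using assms by (simp add: power_mult_distrib fps_X_power_mult_nth)

text \<open>Multiply \<open>(q' o p) * p' = 1\<close> by f^(-m-1) and compare coefficients of index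
  \<open>m\<close>. After expanding \<open>q' o p\<close> in powers of \<open>p\<close>, the residue
  lemma kills every term except \<open>i = m\<close>, which contributes q'_m = (m+1)
  q_(m+1).\<close>

lemma lagrange_inversion:
  fixes f :: "complex fps"
  assumes f0: "fps_nth f 0 \<noteq> 0"
  shows "fps_nth (fps_inv (fps_X * f)) (Suc m) =
    fps_nth (inverse f ^ Suc m) m / of_nat (Suc m)"
proof -
  define p where "p = fps_X * f"
  define q where "q = fps_inv p"
  define A where "A = inverse f"
  have fA: "f * A = 1" using f0 unfolding A_def by (rule inverse_mult_eq_1')
  have p0: "fps_nth p 0 = 0" by (simp add: p_def)
  have p1: "fps_nth p 1 \<noteq> 0" using f0 by (simp add: p_def)
  have "q oo p = fps_X" unfolding q_def by (rule fps_inv[OF p0 p1])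
  then have "fps_deriv (q oo p) = 1" by simp
  then have chain: "(fps_deriv q oo p) * fps_deriv p = 1"
    by (simp add: fps_compose_deriv[OF p0])
  \<comment> \<open>The range \<open>0..m\<close> does not depend on \<open>k\<close>, so that the
    two sums can be exchanged below.\<close>
  have nth: "fps_nth (fps_deriv q oo p) k = (\<Sum>i=0..m. fps_nth (fps_deriv q) i * fps_nth (p ^ i) k)"
    if "k \<le> m" for k
    unfolding fps_compose_nth
    by (rule sum.mono_neutral_left) (use that in \<open>auto simp: p_def fps_X_mult_power_nth_eq_0\<close>)
  \<comment> \<open>Here p^i f^(-m-1) = X^i f^(-(m-i)-1), so the residue lemma applies with
    \<open>r = m - i\<close>.\<close>
  have coef: "fps_nth (p ^ i * (fps_deriv p * A ^ Suc m)) m = (if i = m then 1 else 0)" if i: "i \<le> m" for i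
  proof -
    have "A ^ Suc m = A ^ i * A ^ Suc (m - i)"
      using i by (metis Suc_diff_le le_Suc_eq le_add_diff_inverse power_add)
    then have "p ^ i * (fps_deriv p * A ^ Suc m) = fps_X ^ i * ((f * A) ^ i * (fps_deriv p * A ^ Suc (m - i)))"
      unfolding p_def power_mult_distrib by (simp only: mult_ac)
    also have "\<dots> = fps_X ^ i * (fps_deriv p * A ^ Suc (m - i))"
      unfolding fA by simp
    finally have "fps_nth (p ^ i * (fps_deriv p * A ^ Suc m)) m =
        fps_nth (fps_deriv p * A ^ Suc (m - i)) (m - i)"
      using i by (simp only: fps_X_power_mult_nth) simp
    then show ?thesis
      using i unfolding p_def A_def fps_nth_deriv_X_mult_inverse_power[OF f0] by auto
  qed
  have "fps_nth (A ^ Suc m) m = fps_nth ((fps_deriv q oo p) * (fps_deriv p * A ^ Suc m)) m"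
    using chain by (simp add: mult.assoc[symmetric])
  also have "\<dots> = (\<Sum>k=0..m. (\<Sum>i=0..m. fps_nth (fps_deriv q) i * fps_nth (p ^ i) k) *
      fps_nth (fps_deriv p * A ^ Suc m) (m - k))"
    unfolding fps_mult_nth[of "fps_deriv q oo p"] by (intro sum.cong refl) (simp add: nth)
  also have "\<dots> = (\<Sum>i=0..m. fps_nth (fps_deriv q) i * fps_nth (p ^ i * (fps_deriv p * A ^ Suc m)) m)"
    unfolding fps_mult_nth[of "p ^ _"] sum_distrib_left sum_distrib_right
    by (subst sum.swap) (simp only: mult.assoc)
  also have "\<dots> = (\<Sum>i=0..m. fps_nth (fps_deriv q) i * (if i = m then 1 else 0))"
    by (intro sum.cong refl) (simp only: coef atLeastAtMost_iff)
  also have "\<dots> = of_nat (Suc m) * fps_nth q (Suc m)"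
    by (simp add: if_distrib[of "\<lambda>x. _ * x"] cong: if_cong)
  finally show ?thesis
    unfolding q_def p_def A_def by (simp add: field_simps del: of_nat_Suc)
qed

text \<open>By Lagrange inversion this is the coefficient of Z^(j+1), with index shifted by one, in
  the compositional inverse of \<open>p\<close>.\<close>

definition lag :: "nat \<Rightarrow> (nat \<Rightarrow> complex) \<Rightarrow> nat \<Rightarrow> complex" where
  "lag e x j = fps_nth (inverse (cseries e x) ^ Suc j) j / of_nat (Suc j)"

text \<open>The inverse series truncated after Z^n still inverts \<open>p\<close> up to order
  \<open>n\<close>, since the omitted powers of \<open>p\<close> have order above
  \<open>n\<close>.\<close>

lemma lag_compose_nth:
  assumes "m \<le> n"
  shows "fps_nth (\<Sum>j<n. fps_const (lag e x j) * (fps_X * cseries e x) ^ Suc j) m = fps_nth fps_X m"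
proof -
  define p where "p = fps_X * cseries e x"
  have p0: "fps_nth p 0 = 0" by (simp add: p_def)
  have p1: "fps_nth p 1 \<noteq> 0" by (simp add: p_def cseries_nth)
  have lag: "lag e x j = fps_nth (fps_inv p) (Suc j)" for j
    unfolding p_def lag_def by (rule lagrange_inversion[symmetric]) (simp add: cseries_nth)
  have q0: "fps_nth (fps_inv p) 0 = 0" by (simp add: fps_inv_def)
  have "fps_nth (\<Sum>j<n. fps_const (lag e x j) * p ^ Suc j) m =
      (\<Sum>j<n. fps_nth (fps_inv p) (Suc j) * fps_nth (p ^ Suc j) m)"
    by (simp add: fps_sum_nth lag del: power_Suc)
  also have "\<dots> = (\<Sum>j\<le>n. fps_nth (fps_inv p) j * fps_nth (p ^ j) m)"
    unfolding sum.atMost_shift by (simp add: q0 del: power_Suc)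
  also have "\<dots> = (\<Sum>j=0..m. fps_nth (fps_inv p) j * fps_nth (p ^ j) m)"
    by (rule sum.mono_neutral_right) (use assms in \<open>auto simp: p_def fps_X_mult_power_nth_eq_0\<close>)
  also have "\<dots> = fps_nth (fps_inv p oo p) m" by (simp add: fps_compose_nth)
  also have "fps_inv p oo p = fps_X" by (rule fps_inv[OF p0 p1])
  finally show ?thesis by (simp add: p_def)
qed

text \<open>A divided difference of \<^const>\<open>lag\<close> in the parameters, hence its derivative for \<open>x = y\<close>.\<close>

definition lag_slope :: "nat \<Rightarrow> (nat \<Rightarrow> complex) \<Rightarrow> (nat \<Rightarrow> complex) \<Rightarrow> nat \<Rightarrow> nat \<Rightarrow> complex" where
  "lag_slope e x y j k = (if k \<le> j then - fps_nth (inverse (cseries e x) * inverse (cseries e y) *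
     (\<Sum>i<Suc j. inverse (cseries e x) ^ (Suc j - Suc i) * inverse (cseries e y) ^ i)) (j - k) / of_nat (Suc j) else 0)"

text \<open>An exact identity, not a first order approximation: 1/g - 1/f = - (g - f) / (f g), and a
  difference of powers is the difference of the bases times a geometric sum. The factor
  \<open>g - f\<close> has the coefficients \<open>y k - x k\<close> for
  \<open>1 \<le> k \<le> e\<close> and no others.\<close>

lemma lag_diff:
  "lag e y j - lag e x j = (\<Sum>k=1..e. lag_slope e x y j k * (y k - x k))"
proof -
  define A where "A = inverse (cseries e x)"
  define B where "B = inverse (cseries e y)"
  define C where "C = A * B * (\<Sum>i<Suc j. A ^ (Suc j - Suc i) * B ^ i)"
  define H where "H = cseries e y - cseries e x"
  have Ax: "A * cseries e x = 1" and By: "B * cseries e y = 1"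
    unfolding A_def B_def by (rule inverse_mult_cseries)+
  have "B - A = (A * cseries e x) * B - A * (B * cseries e y)" using Ax By by simp
  also have "\<dots> = - (A * B * H)" unfolding H_def by (simp add: algebra_simps)
  finally have BA: "B - A = - (A * B * H)" .
  have "B ^ Suc j - A ^ Suc j = (B - A) * (\<Sum>i<Suc j. A ^ (Suc j - Suc i) * B ^ i)"
    by (rule power_diff_sumr2)
  also have "\<dots> = - (H * C)" unfolding BA C_def by (simp only: mult_ac mult_minus_left)
  finally have "fps_nth (B ^ Suc j) j - fps_nth (A ^ Suc j) j = - fps_nth (H * C) j"
    by (metis fps_neg_nth fps_sub_nth)
  also have "fps_nth (H * C) j = (\<Sum>k=0..j. fps_nth H k * fps_nth C (j - k))"
    by (rule fps_mult_nth)
  also have "\<dots> = (\<Sum>k\<in>{1..e} \<inter> {..j}. (y k - x k) * fps_nth C (j - k))"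
    by (rule sum.mono_neutral_cong_right) (auto simp: H_def cseries_nth)
  also have "\<dots> = (\<Sum>k=1..e. if k \<le> j then (y k - x k) * fps_nth C (j - k) else 0)"
    by (simp only: sum.inter_restrict finite_atLeastAtMost atMost_iff)
  finally have "lag e y j - lag e x j =
      - (\<Sum>k=1..e. if k \<le> j then (y k - x k) * fps_nth C (j - k) else 0) / of_nat (Suc j)"
    unfolding lag_def A_def B_def by (simp add: diff_divide_distrib[symmetric] del: of_nat_Suc power_Suc)
  also have "\<dots> = (\<Sum>k=1..e. lag_slope e x y j k * (y k - x k))"
    unfolding sum_negf[symmetric] sum_divide_distrib
    by (intro sum.cong refl) (simp add: lag_slope_def A_def B_def C_def mult_ac del: of_nat_Suc)
  finally show ?thesis .
qed

text \<open>For equal arguments the \<open>j + 1\<close> summands coincide and cancel the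
  denominator. For positive \<open>j\<close> and \<open>k\<close> the result is minus the value of
  \<open>alpha (k - 1) (j - 1) e\<close>, which makes \<open>apoly\<close> a Jacobian up to
  sign.\<close>

lemma lag_slope_self:
  "lag_slope e x x j k = (if k \<le> j then - fps_nth (inverse (cseries e x) ^ Suc (Suc j)) (j - k) else 0)"
proof -
  define A where "A = inverse (cseries e x)"
  have "(\<Sum>i<Suc j. A ^ (Suc j - Suc i) * A ^ i) = (\<Sum>i<Suc j. A ^ j)"
    by (intro sum.cong refl) (simp add: power_add[symmetric])
  also have "\<dots> = fps_const (of_nat (Suc j)) * A ^ j"
    by (simp add: fps_of_nat del: of_nat_Suc)
  finally have "A * A * (\<Sum>i<Suc j. A ^ (Suc j - Suc i) * A ^ i) = fps_const (of_nat (Suc j)) * A ^ Suc (Suc j)"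
    by (simp add: mult_ac)
  then show ?thesis
    unfolding lag_slope_def A_def[symmetric] by (simp del: of_nat_Suc power_Suc)
qed


section \<open>Curves with prescribed inverse coefficients\<close>

text \<open>Functions of \<open>s\<close> rather than elements of a polynomial ring: closure rules
  then apply directly to formulas, and limits at 0 are values at 0.\<close>

definition polyfun :: "(complex \<Rightarrow> complex) \<Rightarrow> bool" where
  "polyfun f \<longleftrightarrow> (\<exists>p. f = poly p)"

named_theorems polyfun_intros

lemma polyfun_poly [polyfun_intros]: "polyfun (poly p)"
  by (auto simp: polyfun_def)

lemma polyfun_const [polyfun_intros]: "polyfun (\<lambda>s. c)"
proof -
  have "(\<lambda>s. c) = poly [:c:]" by (rule ext) simp
  then show ?thesis unfolding polyfun_def by blast
qed

lemma polyfun_id [polyfun_intros]: "polyfun (\<lambda>s. s)"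
proof -
  have "(\<lambda>s. s) = poly [:0, 1 :: complex:]" by (rule ext) simp
  then show ?thesis unfolding polyfun_def by blast
qed

lemma polyfun_add [polyfun_intros]:
  assumes "polyfun f" "polyfun g"
  shows "polyfun (\<lambda>s. f s + g s)"
proof -
  obtain p q where "f = poly p" "g = poly q" using assms by (auto simp: polyfun_def)
  then have "(\<lambda>s. f s + g s) = poly (p + q)" by auto
  then show ?thesis unfolding polyfun_def by blast
qed

lemma polyfun_mult [polyfun_intros]:
  assumes "polyfun f" "polyfun g"
  shows "polyfun (\<lambda>s. f s * g s)"
proof -
  obtain p q where "f = poly p" "g = poly q" using assms by (auto simp: polyfun_def)
  then have "(\<lambda>s. f s * g s) = poly (p * q)" by auto
  then show ?thesis unfolding polyfun_def by blast
qed

lemma polyfun_minus [polyfun_intros]: "polyfun f \<Longrightarrow> polyfun (\<lambda>s. - f s)"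
  using polyfun_mult[OF polyfun_const[of "-1"], of f] by simp

lemma polyfun_diff [polyfun_intros]: "polyfun f \<Longrightarrow> polyfun g \<Longrightarrow> polyfun (\<lambda>s. f s - g s)"
  using polyfun_add[of f "\<lambda>s. - g s"] polyfun_minus[of g] by simp

lemma polyfun_divide [polyfun_intros]: "polyfun f \<Longrightarrow> polyfun (\<lambda>s. f s / c)"
  using polyfun_mult[OF _ polyfun_const[of "inverse c"], of f] by (simp add: divide_inverse)

lemma polyfun_sum [polyfun_intros]:
  "(\<And>i. i \<in> I \<Longrightarrow> polyfun (f i)) \<Longrightarrow> polyfun (\<lambda>s. \<Sum>i\<in>I. f i s)"
  by (induction I rule: infinite_finite_induct) (auto intro: polyfun_intros)

lemma polyfun_power [polyfun_intros]: "polyfun f \<Longrightarrow> polyfun (\<lambda>s. f s ^ n)"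
  by (induction n) (auto intro: polyfun_intros)

lemma polyfun_factor:
  assumes "polyfun f" "f 0 = 0"
  obtains g where "polyfun g" "\<And>s. f s = s * g s"
proof -
  obtain p where p: "f = poly p" using assms by (auto simp: polyfun_def)
  then have "[:- 0, 1:] dvd p" using assms by (subst poly_eq_0_iff_dvd[symmetric]) auto
  then obtain q where "p = [:0, 1:] * q" by auto
  then show ?thesis using p that[of "poly q"] by (auto simp: polyfun_intros)
qed

lemma polyfun_tendsto:
  assumes "polyfun f"
  shows "(f \<longlongrightarrow> f a) (at a)"
  using assms unfolding polyfun_def by (auto intro: tendsto_intros)

text \<open>A nonzero polynomial has finitely many roots, and a punctured neighbourhood avoids a
  root at \<open>a\<close> itself.\<close>

lemma polyfun_eventually_nonzero:
  assumes "polyfun f" "f s \<noteq> 0"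
  shows "eventually (\<lambda>s. f s \<noteq> 0) (at a)"
proof -
  obtain p where p: "f = poly p" using assms by (auto simp: polyfun_def)
  then have "p \<noteq> 0" using assms by auto
  then have "finite {s. f s = 0}" unfolding p by (rule poly_roots_finite)
  then have "open (- ({s. f s = 0} - {a}))" by (intro open_Compl finite_imp_closed) auto
  then have "eventually (\<lambda>s. s \<in> - ({s. f s = 0} - {a})) (nhds a)"
    by (rule eventually_nhds_in_open) auto
  then show ?thesis
    unfolding eventually_at_filter by (rule eventually_mono) auto
qed

text \<open>Each coefficient is polynomial in \<open>s\<close>, without a common bound on the
  degrees, so that inverses stay in the class.\<close>

definition polyfps :: "(complex \<Rightarrow> complex fps) \<Rightarrow> bool" where
  "polyfps F \<longleftrightarrow> (\<forall>n. polyfun (\<lambda>s. fps_nth (F s) n))"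

lemma polyfps_mult:
  assumes "polyfps F" "polyfps G"
  shows "polyfps (\<lambda>s. F s * G s)"
  using assms unfolding polyfps_def fps_mult_nth by (auto intro!: polyfun_intros)

lemma polyfps_power:
  assumes "polyfps F"
  shows "polyfps (\<lambda>s. F s ^ n)"
proof (induction n)
  case 0
  show ?case by (auto simp: polyfps_def intro: polyfun_intros)
next
  case (Suc n)
  then show ?case using polyfps_mult[OF assms Suc] by simp
qed

lemma polyfps_sum:
  assumes "\<And>i. i \<in> I \<Longrightarrow> polyfps (F i)"
  shows "polyfps (\<lambda>s. \<Sum>i\<in>I. F i s)"
  using assms unfolding polyfps_def fps_sum_nth by (auto intro!: polyfun_intros)

lemma polyfps_cseries:
  assumes "\<And>k. polyfun (\<lambda>s. x s k)"
  shows "polyfps (\<lambda>s. cseries e (x s))"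
  unfolding polyfps_def cseries_nth
proof
  fix n
  show "polyfun (\<lambda>s. if n = 0 then 1 else if n \<le> e then x s n else 0)"
    using assms by (cases "n = 0"; cases "n \<le> e") (auto intro: polyfun_intros)
qed

text \<open>The constant coefficient 1 makes the recursion for the coefficients of the inverse free
  of divisions.\<close>

lemma polyfps_inverse:
  assumes F: "polyfps F" and F0: "\<And>s. fps_nth (F s) 0 = 1"
  shows "polyfps (\<lambda>s. inverse (F s))"
  unfolding polyfps_def
proof
  fix n
  show "polyfun (\<lambda>s. fps_nth (inverse (F s)) n)"
  proof (induction n rule: less_induct)
    case (less n)
    show ?case
    proof (cases n)
      case 0
      then show ?thesis using F0 by (auto intro: polyfun_intros)
    next
      case (Suc m)
      have "fps_nth (inverse (F s)) n = - (\<Sum>i=1..n. fps_nth (F s) i * fps_nth (inverse (F s)) (n - i))" for s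
      proof -
        have "F s * inverse (F s) = 1" using F0 by (intro inverse_mult_eq_1') auto
        then have "0 = fps_nth (F s * inverse (F s)) n" using Suc by simp
        also have "\<dots> = fps_nth (inverse (F s)) n + (\<Sum>i=1..n. fps_nth (F s) i * fps_nth (inverse (F s)) (n - i))"
          by (simp add: fps_mult_nth sum.atLeast_Suc_atMost F0)
        finally show ?thesis by (simp add: eq_neg_iff_add_eq_0)
      qed
      moreover have "polyfun (\<lambda>s. fps_nth (F s) i * fps_nth (inverse (F s)) (n - i))" if "i \<in> {1..n}" for i
        using that F less.IH[of "n - i"] by (auto simp: polyfps_def intro!: polyfun_intros)
      ultimately show ?thesis by (simp only:) (intro polyfun_minus polyfun_sum)
    qed
  qed
qed

lemma polyfps_inverse_cseries:
  assumes "\<And>k. polyfun (\<lambda>s. x s k)"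
  shows "polyfps (\<lambda>s. inverse (cseries e (x s)))"
  by (intro polyfps_inverse polyfps_cseries assms) (simp add: cseries_nth)

lemma polyfun_lag:
  assumes "\<And>k. polyfun (\<lambda>s. x s k)"
  shows "polyfun (\<lambda>s. lag e (x s) j)"
  using polyfps_power[OF polyfps_inverse_cseries[of x e, OF assms], of "Suc j"]
  unfolding lag_def polyfps_def by (intro polyfun_divide) blast

lemma polyfun_lag_slope:
  assumes "\<And>k. polyfun (\<lambda>s. x s k)" "\<And>k. polyfun (\<lambda>s. y s k)"
  shows "polyfun (\<lambda>s. lag_slope e (x s) (y s) j k)"
proof (cases "k \<le> j")
  case True
  have "polyfps (\<lambda>s. inverse (cseries e (x s)) * inverse (cseries e (y s)) *
     (\<Sum>i<Suc j. inverse (cseries e (x s)) ^ (Suc j - Suc i) * inverse (cseries e (y s)) ^ i))"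
    by (intro polyfps_mult polyfps_sum polyfps_power polyfps_inverse_cseries assms)
  then show ?thesis
    using True unfolding lag_slope_def polyfps_def
    by (simp only: if_True) (intro polyfun_intros, blast)
qed (simp add: lag_slope_def polyfun_intros)

text \<open>Chord method: correcting \<open>x\<close> by the inverse Jacobian at \<open>x0\<close>, applied to the error, gains a
  factor \<open>s\<close> because the divided differences along the curve agree with that Jacobian at \<open>s = 0\<close>.\<close>

lemma lag_curve:
  assumes M: "\<And>l m. l < e \<Longrightarrow> m < e \<Longrightarrow>
      (\<Sum>i<e. lag_slope e x0 x0 (d + l) (Suc i) * M i m) = (if l = m then 1 else 0)"
    and t: "\<And>l. l < e \<Longrightarrow> polyfun (t l)"
    and t0: "\<And>l. l < e \<Longrightarrow> t l 0 = lag e x0 (d + l)"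
  shows "\<exists>x. (\<forall>k. polyfun (\<lambda>s. x s k)) \<and> x 0 = x0 \<and>
    (\<forall>l<e. \<exists>h. polyfun h \<and> (\<forall>s. t l s - lag e (x s) (d + l) = s ^ Suc N * h s))"
proof (induction N)
  case 0
  \<comment> \<open>The constant curve \<open>x0\<close> hits the target at \<open>s = 0\<close>, so
    the error has a first factor \<open>s\<close>.\<close>
  have "\<exists>h. polyfun h \<and> (\<forall>s. t l s - lag e x0 (d + l) = s ^ Suc 0 * h s)" if l: "l < e" for l
  proof -
    have "polyfun (\<lambda>s. t l s - lag e x0 (d + l))" by (intro polyfun_intros t l)
    then obtain h where "polyfun h" "\<And>s. t l s - lag e x0 (d + l) = s * h s"
      by (rule polyfun_factor) (use t0[OF l] in auto)
    then show ?thesis by auto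
  qed
  then show ?case by (intro exI[of _ "\<lambda>s. x0"]) (auto intro: polyfun_intros)
next
  case (Suc N)
  then obtain x where x: "\<And>k. polyfun (\<lambda>s. x s k)" and x_0: "x 0 = x0"
    and "\<forall>l\<in>{..<e}. \<exists>h. polyfun h \<and> (\<forall>s. t l s - lag e (x s) (d + l) = s ^ Suc N * h s)"
    by auto
  then obtain h where h: "\<And>l. l < e \<Longrightarrow> polyfun (h l)"
    and th: "\<And>l s. l < e \<Longrightarrow> t l s - lag e (x s) (d + l) = s ^ Suc N * h l s"
    unfolding bchoice_iff by blast
  \<comment> \<open>Row \<open>k - 1\<close> of \<open>M\<close> belongs to the parameter x_k. The
    correction vanishes at \<open>s = 0\<close>, so the new curve still starts at
    \<open>x0\<close>.\<close>
  define y where "y s k = x s k + s ^ Suc N * (\<Sum>m<e. M (k - 1) m * h m s)" for s k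
  have y: "polyfun (\<lambda>s. y s k)" for k
    unfolding y_def by (intro polyfun_intros x h) auto
  have y_0: "y 0 = x0" by (rule ext) (simp add: y_def x_0)
  \<comment> \<open>The secant Jacobian between the two curves, times \<open>M\<close>. At
    \<open>s = 0\<close> both curves are at \<open>x0\<close>, and the product is the identity
    matrix.\<close>
  define K where "K l m s = (\<Sum>i<e. lag_slope e (x s) (y s) (d + l) (Suc i) * M i m)" for l m s
  have K: "polyfun (K l m)" for l m
    unfolding K_def by (intro polyfun_intros polyfun_lag_slope x y)
  have K_0: "K l m 0 = (if l = m then 1 else 0)" if "l < e" "m < e" for l m
    unfolding K_def x_0 y_0 by (rule M[OF that])
  have step: "lag e (y s) (d + l) - lag e (x s) (d + l) = s ^ Suc N * (\<Sum>m<e. K l m s * h m s)" for l s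
  proof -
    have "lag e (y s) (d + l) - lag e (x s) (d + l) =
        (\<Sum>i<e. lag_slope e (x s) (y s) (d + l) (Suc i) * (s ^ Suc N * (\<Sum>m<e. M i m * h m s)))"
      unfolding lag_diff One_nat_def sum.atLeast1_atMost_eq by (simp add: y_def)
    also have "\<dots> = s ^ Suc N * (\<Sum>i<e. \<Sum>m<e. lag_slope e (x s) (y s) (d + l) (Suc i) * M i m * h m s)"
      unfolding sum_distrib_left by (intro sum.cong refl) (simp add: mult_ac)
    also have "(\<Sum>i<e. \<Sum>m<e. lag_slope e (x s) (y s) (d + l) (Suc i) * M i m * h m s) = (\<Sum>m<e. K l m s * h m s)"
      unfolding K_def sum_distrib_right by (rule sum.swap)
    finally show ?thesis .
  qed
  have "\<exists>g. polyfun g \<and> (\<forall>s. t l s - lag e (y s) (d + l) = s ^ Suc (Suc N) * g s)" if l: "l < e" for l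
  proof -
    \<comment> \<open>The remaining error is \<open>s^(N+1)\<close> times \<open>h - K h\<close>,
      and this difference vanishes at \<open>s = 0\<close>.\<close>
    have "polyfun (\<lambda>s. h l s - (\<Sum>m<e. K l m s * h m s))"
      by (intro polyfun_intros h l K) auto
    moreover have "h l 0 - (\<Sum>m<e. K l m 0 * h m 0) = 0"
    proof -
      have "(\<Sum>m<e. K l m 0 * h m 0) = (\<Sum>m<e. if l = m then h m 0 else 0)"
        by (intro sum.cong refl) (simp add: K_0 l)
      then show ?thesis using l by simp
    qed
    ultimately obtain g where g: "polyfun g" "\<And>s. h l s - (\<Sum>m<e. K l m s * h m s) = s * g s"
      by (rule polyfun_factor) blast
    have "t l s - lag e (y s) (d + l) = s ^ Suc (Suc N) * g s" for s
    proof -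
      have "t l s - lag e (y s) (d + l) = s ^ Suc N * h l s - s ^ Suc N * (\<Sum>m<e. K l m s * h m s)"
        using th[OF l, of s] step[of s l] by (simp add: algebra_simps)
      also have "\<dots> = s ^ Suc N * (s * g s)" unfolding g(2)[symmetric] by (simp only: right_diff_distrib)
      finally show ?thesis by simp
    qed
    then show ?thesis using g(1) by blast
  qed
  then show ?case using y y_0 by blast
qed


section \<open>Specializations as evaluations\<close>

lemma polys_in_0: "0 \<in> polys_in V"
  by (simp add: polys_in_def)

lemma polys_in_add: "p \<in> polys_in V \<Longrightarrow> q \<in> polys_in V \<Longrightarrow> p + q \<in> polys_in V"
  using Poly_Mapping.keys_add[of p q] unfolding polys_in_def by blast

lemma polys_in_sum: "(\<And>i. i \<in> I \<Longrightarrow> f i \<in> polys_in V) \<Longrightarrow> sum f I \<in> polys_in V"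
  by (induction I rule: infinite_finite_induct) (auto intro: polys_in_0 polys_in_add)

lemma polys_in_single: "Poly_Mapping.keys m \<subseteq> V \<Longrightarrow> Poly_Mapping.single m c \<in> polys_in V"
  by (simp add: polys_in_def)

lemma polys_in_1: "1 \<in> polys_in V"
  by (simp add: polys_in_def)

lemma polys_in_prod: "(\<And>i. i \<in> I \<Longrightarrow> f i \<in> polys_in V) \<Longrightarrow> prod f I \<in> polys_in V"
  by (induction I rule: infinite_finite_induct) (auto intro: polys_in_1 polys_in_mult)

lemma polys_in_minus: "p \<in> polys_in V \<Longrightarrow> - p \<in> polys_in V"
  by (simp add: polys_in_def)

lemma polys_in_det:
  assumes A: "A \<in> carrier_mat n n" and "\<And>i j. i < n \<Longrightarrow> j < n \<Longrightarrow> A $$ (i, j) \<in> polys_in V"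
  shows "det A \<in> polys_in V"
  unfolding det_def'[OF A]
proof (rule polys_in_sum)
  fix p assume p: "p \<in> {p. p permutes {0..<n}}"
  then have "p i < n" if "i < n" for i
    using that permutes_in_image[of p "{0..<n}" i] by simp
  then have "(\<Prod>i = 0..<n. A $$ (i, p i)) \<in> polys_in V"
    using assms(2) by (intro polys_in_prod) auto
  then show "signof p * (\<Prod>i = 0..<n. A $$ (i, p i)) \<in> polys_in V"
    by (simp add: sign_def polys_in_minus)
qed

lemma comm_ring_hom_mp_eval: "comm_ring_hom (mp_eval \<phi>)"
proof
  show "mp_eval \<phi> 0 = 0" "mp_eval \<phi> 1 = 1"
    by (simp_all add: mp_eval_def)
qed (rule mp_eval_add mp_eval_mult)+

lemma single_add_1: "Poly_Mapping.single (m + n) 1 = (Poly_Mapping.single m 1 * Poly_Mapping.single n 1 :: 'v mpoly)"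
  by (simp add: mult_single)

lemma single_single_power:
  "Poly_Mapping.single (Poly_Mapping.single v n) 1 = (Poly_Mapping.single (Poly_Mapping.single v (Suc 0)) 1 :: 'v mpoly) ^ n"
proof (induction n)
  case (Suc n)
  have "Poly_Mapping.single v (Suc n) = Poly_Mapping.single v (Suc 0) + Poly_Mapping.single v n"
    by (simp flip: single_add)
  then show ?case using Suc by (simp add: single_add_1)
qed simp

lemma single_sum_prod:
  "Poly_Mapping.single (sum f I) 1 = (\<Prod>i\<in>I. Poly_Mapping.single (f i) 1 :: 'v mpoly)"
proof (induction I rule: infinite_finite_induct)
  case (insert i I)
  then show ?case by (simp add: single_add_1)
qed simp_all

lemma poly_mapping_expansion:
  "m = (\<Sum>v\<in>Poly_Mapping.keys m. Poly_Mapping.single v (Poly_Mapping.lookup m v))"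
  by (rule poly_mapping_eqI) (auto simp: lookup_sum lookup_single when_def in_keys_iff)

text \<open>The point has the coordinates \<open>\<psi> (X v)\<close>; multiplicativity settles
  monomials and additivity the rest. At an actual point the power series above can be
  formed.\<close>

lemma alg_hom_on_eq_mp_eval:
  assumes hom: "alg_hom_on V \<psi>"
  obtains \<phi> where "\<And>p. p \<in> polys_in V \<Longrightarrow> \<psi> p = mp_eval \<phi> p"
proof
  define X :: "'a \<Rightarrow> 'a mpoly" where "X v = Poly_Mapping.single (Poly_Mapping.single v (Suc 0)) 1" for v
  have add: "\<psi> (p + q) = \<psi> p + \<psi> q" and mult: "\<psi> (p * q) = \<psi> p * \<psi> q"
    if "p \<in> polys_in V" "q \<in> polys_in V" for p q
    using hom that by (auto simp: alg_hom_on_def)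
  have const: "\<psi> (Poly_Mapping.single 0 c) = c" for c
    using hom by (auto simp: alg_hom_on_def)
  have zero: "\<psi> 0 = 0" and one: "\<psi> 1 = 1"
    using const[of 0] const[of 1] by simp_all
  have sum: "\<psi> (sum f I) = (\<Sum>i\<in>I. \<psi> (f i))" if "\<And>i. i \<in> I \<Longrightarrow> f i \<in> polys_in V"
    for f and I :: "('a \<Rightarrow>\<^sub>0 nat) set"
    using that by (induction I rule: infinite_finite_induct) (auto simp: zero add polys_in_sum)
  have prod: "\<psi> (prod f I) = (\<Prod>i\<in>I. \<psi> (f i))" if "\<And>i. i \<in> I \<Longrightarrow> f i \<in> polys_in V"
    for f and I :: "'a set"
    using that by (induction I rule: infinite_finite_induct) (auto simp: one mult polys_in_prod)
  have power: "p ^ n \<in> polys_in V \<and> \<psi> (p ^ n) = \<psi> p ^ n" if "p \<in> polys_in V" for p n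
    using that by (induction n) (auto simp: one mult polys_in_1 polys_in_mult)
  have X: "X v \<in> polys_in V" if "v \<in> V" for v
    using that unfolding X_def by (intro polys_in_single) simp
  have mono: "\<psi> (Poly_Mapping.single m c) = mp_eval (\<lambda>v. \<psi> (X v)) (Poly_Mapping.single m c)"
    if m: "Poly_Mapping.keys m \<subseteq> V" for m c
  proof -
    have e: "Poly_Mapping.single m 1 = (\<Prod>v\<in>Poly_Mapping.keys m. X v ^ Poly_Mapping.lookup m v)"
      by (subst poly_mapping_expansion[of m]) (unfold single_sum_prod X_def, intro prod.cong refl single_single_power)
    have "\<psi> (Poly_Mapping.single m 1) = (\<Prod>v\<in>Poly_Mapping.keys m. \<psi> (X v ^ Poly_Mapping.lookup m v))"
      unfolding e by (rule prod) (use m X power in blast)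
    also have "\<dots> = (\<Prod>v\<in>Poly_Mapping.keys m. \<psi> (X v) ^ Poly_Mapping.lookup m v)"
      by (rule prod.cong) (use m X power in blast)+
    finally have "\<psi> (Poly_Mapping.single m 1) = \<dots>" .
    moreover have "\<psi> (Poly_Mapping.single 0 c * Poly_Mapping.single m 1) = c * \<psi> (Poly_Mapping.single m 1)"
      using m by (subst mult) (auto intro: polys_in_single simp: const)
    ultimately show ?thesis by (simp add: mp_eval_single mult_single)
  qed
  fix p assume p: "p \<in> polys_in V"
  have "\<psi> p = \<psi> (\<Sum>m\<in>Poly_Mapping.keys p. Poly_Mapping.single m (Poly_Mapping.lookup p m))"
    by (simp flip: mpoly_expansion)
  also have "\<dots> = (\<Sum>m\<in>Poly_Mapping.keys p. \<psi> (Poly_Mapping.single m (Poly_Mapping.lookup p m)))"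
    by (rule sum) (use p in \<open>auto simp: polys_in_def\<close>)
  also have "\<dots> = (\<Sum>m\<in>Poly_Mapping.keys p. mp_eval (\<lambda>v. \<psi> (X v)) (Poly_Mapping.single m (Poly_Mapping.lookup p m)))"
    by (rule sum.cong) (use p mono in \<open>auto simp: polys_in_def\<close>)
  also have "\<dots> = mp_eval (\<lambda>v. \<psi> (X v)) p"
    by (simp flip: mp_eval_sum mpoly_expansion)
  finally show "\<psi> p = mp_eval (\<lambda>v. \<psi> (X v)) p" .
qed

section \<open>Values of g, alpha and the determinant at a point\<close>

lemma mp_eval_expseq:
  assumes "a \<in> expseqs e"
  shows "mp_eval \<phi> (Poly_Mapping.single a c) = c * (\<Prod>k=1..e. \<phi> k ^ Poly_Mapping.lookup a k)"
proof -
  have "(\<Prod>k\<in>Poly_Mapping.keys a. \<phi> k ^ Poly_Mapping.lookup a k) = (\<Prod>k=1..e. \<phi> k ^ Poly_Mapping.lookup a k)"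
    by (rule prod.mono_neutral_left) (use assms in \<open>auto simp: expseqs_def in_keys_iff\<close>)
  then show ?thesis by (simp add: mp_eval_single)
qed

lemma gpoly_in: "gpoly d e \<in> polys_in {1..e}"
  unfolding gpoly_def by (intro polys_in_sum polys_in_single) (simp add: expseqs_def)

lemma alpha_in: "alpha i j e \<in> polys_in {1..e}"
  unfolding alpha_def by (intro polys_in_sum polys_in_single) (simp add: expseqs_def)

lemma apoly_in: "apoly d e \<in> polys_in {1..e}"
  unfolding apoly_def by (rule polys_in_det[where n = e]) (simp_all add: alpha_in del: One_nat_def)

lemma mp_eval_gpoly: "mp_eval \<phi> (gpoly j e) = lag e \<phi> j"
proof -
  have "mp_eval \<phi> (gpoly j e) = (\<Sum>a | a \<in> expseqs e \<and> eweight e a = j. mterm e \<phi> j a / of_nat (Suc j))"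
    unfolding gpoly_def mp_eval_sum
    by (intro sum.cong refl) (simp add: mp_eval_expseq[of _ e] mterm_def del: of_nat_Suc)
  then show ?thesis
    unfolding lag_def inverse_cseries_power_nth sum_divide_distrib .
qed

lemma mp_eval_alpha:
  "mp_eval \<phi> (alpha i j e) =
     (if i \<le> j then fps_nth (inverse (cseries e \<phi>) ^ Suc (j + 2)) (j - i) else 0)"
proof -
  have "mp_eval \<phi> (alpha i j e) = (\<Sum>a | a \<in> expseqs e \<and> eweight e a + i = j. mterm e \<phi> (j + 2) a)"
    unfolding alpha_def mp_eval_sum
    by (intro sum.cong refl) (simp add: mp_eval_expseq[of _ e] mterm_def)
  \<comment> \<open>Subtraction of natural numbers is truncated, so \<open>i > j\<close> is a
    separate case with an empty sum.\<close>
  also have "{a. a \<in> expseqs e \<and> eweight e a + i = j} =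
      (if i \<le> j then {a. a \<in> expseqs e \<and> eweight e a = j - i} else {})"
    by auto
  finally show ?thesis
    by (simp only: inverse_cseries_power_nth if_distrib[of "sum _"] sum.empty)
qed

lemma det_nonzero_inverse:
  fixes A :: "'a :: field mat"
  assumes A: "A \<in> carrier_mat n n" and "det A \<noteq> 0"
  obtains B where "B \<in> carrier_mat n n" "B * A = 1\<^sub>m n"
proof -
  have "A \<in> Units (ring_mat TYPE('a) n ())" by (rule det_non_zero_imp_unit[OF assms])
  then show ?thesis using that unfolding Units_def ring_mat_def by auto
qed

text \<open>At \<open>\<phi>\<close> the matrix of \<open>apoly\<close> has in row \<open>i\<close>,
  column \<open>l\<close> minus the derivative of g_(d+l) with respect to x_(i+1). It is minus the
  transposed Jacobian, so \<open>M\<close> is minus the transpose of its inverse.\<close>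

lemma slope_inverse:
  assumes d: "d \<ge> 1" and nz: "mp_eval \<phi> (apoly d e) \<noteq> 0"
  obtains M where "\<And>l m. l < e \<Longrightarrow> m < e \<Longrightarrow>
      (\<Sum>i<e. lag_slope e \<phi> \<phi> (d + l) (Suc i) * M i m) = (if l = m then 1 else 0)"
proof -
  interpret comm_ring_hom "mp_eval \<phi>" by (rule comm_ring_hom_mp_eval)
  define A where "A = mat e e (\<lambda>(i, l). - lag_slope e \<phi> \<phi> (d + l) (Suc i))"
  have A: "A \<in> carrier_mat e e" by (simp add: A_def)
  have "map_mat (mp_eval \<phi>) (mat e e (\<lambda>(i, l). alpha i (d - 1 + l) e)) = A"
  proof (rule eq_matI)
    fix i l assume "i < dim_row A" "l < dim_col A"
    then have il: "i < e" "l < e" by (simp_all add: A_def)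
    \<comment> \<open>Positivity of \<open>d\<close> is what makes the truncated
      \<open>d - 1 + l\<close> equal to \<open>d + l - 1\<close>.\<close>
    obtain d' where d': "d = Suc d'" using d by (cases d) auto
    show "map_mat (mp_eval \<phi>) (mat e e (\<lambda>(i, l). alpha i (d - 1 + l) e)) $$ (i, l) = A $$ (i, l)"
      using il unfolding A_def lag_slope_self d' by (simp add: mp_eval_alpha del: power_Suc)
  qed (simp_all add: A_def)
  then have "det A = mp_eval \<phi> (apoly d e)"
    unfolding apoly_def hom_det[symmetric] by simp
  then obtain B where B: "B \<in> carrier_mat e e" and BA: "B * A = 1\<^sub>m e"
    using det_nonzero_inverse[OF A] nz by metis
  show ?thesis
  proof (rule that)
    fix l m assume lm: "l < e" "m < e"
    have "(\<Sum>i<e. lag_slope e \<phi> \<phi> (d + l) (Suc i) * - B $$ (m, i)) = (\<Sum>i<e. B $$ (m, i) * A $$ (i, l))"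
      using lm by (intro sum.cong refl) (simp add: A_def)
    also have "\<dots> = (B * A) $$ (m, l)"
      using A B lm by (simp add: scalar_prod_def lessThan_atLeast0)
    also have "\<dots> = (if l = m then 1 else 0)"
      unfolding BA using lm by auto
    finally show "(\<Sum>i<e. lag_slope e \<phi> \<phi> (d + l) (Suc i) * - B $$ (m, i)) = (if l = m then 1 else 0)" .
  qed
qed


section \<open>The degenerating family\<close>

lemma sum_lessThan_add:
  fixes F :: "nat \<Rightarrow> 'a :: comm_monoid_add"
  shows "(\<Sum>j<m + k. F j) = (\<Sum>j<m. F j) + (\<Sum>l<k. F (m + l))"
  by (induction k) (simp_all add: add.assoc)

lemma coeff_sum_monom: "coeff (\<Sum>j\<le>n. monom (a j) j) i = (if i \<le> n then a i else 0)"
  by (simp add: coeff_sum)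

lemma degree_sum_monom: "degree (\<Sum>j\<le>n. monom (a j) j) \<le> n"
  by (rule degree_le) (simp add: coeff_sum_monom)

lemma poly_sum_monom:
  fixes z :: "'a :: comm_semiring_1"
  shows "poly (\<Sum>j\<le>n. monom (a j) j) z = (\<Sum>j\<le>n. a j * z ^ j)"
  by (simp add: poly_sum poly_monom)

text \<open>Used to make the top coefficients nonzero, so that the polydegree is exactly \<open>(d, e+1)\<close>.\<close>

lemma polyfun_nonzero_perturb:
  assumes "polyfun f"
  obtains c where "eventually (\<lambda>s. f s + c * s ^ k \<noteq> 0) (at a)"
proof -
  \<comment> \<open>At \<open>s = 1\<close> the power of \<open>s\<close> is 1, so one of
    \<open>c = 0\<close> and \<open>c = 1\<close> gives a nonzero value.\<close>
  obtain c s where "f s + c * s ^ k \<noteq> 0"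
  proof (cases "f 1 = 0")
    case True
    then show ?thesis using that[of 1 1] by simp
  next
    case False
    then show ?thesis using that[of 1 0] by simp
  qed
  moreover have "polyfun (\<lambda>s. f s + c * s ^ k)" by (intro polyfun_intros assms)
  ultimately show ?thesis using polyfun_eventually_nonzero[of "\<lambda>s. f s + c * s ^ k" s a] that by blast
qed

text \<open>The chord method gives a curve with error of order \<open>e\<close>. Adding
  \<open>c * s^e\<close> to its last parameter makes the leading coefficient of \<open>p\<close>
  nonzero near 0 and, by \<open>lag_diff\<close>, changes the error only by a multiple of
  \<open>s^e\<close>.\<close>

lemma lag_curve_nonzero:
  assumes e: "e \<ge> 1"
    and M: "\<And>l m. l < e \<Longrightarrow> m < e \<Longrightarrow>
      (\<Sum>i<e. lag_slope e x0 x0 (d + l) (Suc i) * M i m) = (if l = m then 1 else 0)"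
    and t: "\<And>l. l < e \<Longrightarrow> polyfun (t l)"
    and t0: "\<And>l. l < e \<Longrightarrow> t l 0 = lag e x0 (d + l)"
  obtains x h where "\<And>k. polyfun (\<lambda>s. x s k)" "x 0 = x0"
    "eventually (\<lambda>s. x s e \<noteq> 0) (at 0)" "\<And>l. l < e \<Longrightarrow> polyfun (h l)"
    "\<And>l s. l < e \<Longrightarrow> t l s - lag e (x s) (d + l) = s ^ e * h l s"
proof -
  \<comment> \<open>The order reached by \<open>lag_curve\<close> is \<open>Suc N\<close>, hence the
    shift.\<close>
  obtain N where N: "e = Suc N" using e by (cases e) auto
  obtain x where x: "\<And>k. polyfun (\<lambda>s. x s k)" and x_0: "x 0 = x0"
    and "\<forall>l<e. \<exists>h. polyfun h \<and> (\<forall>s. t l s - lag e (x s) (d + l) = s ^ e * h s)"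
    using lag_curve[OF M t t0, of N] N by blast
  then have "\<forall>l\<in>{..<e}. \<exists>h. polyfun h \<and> (\<forall>s. t l s - lag e (x s) (d + l) = s ^ e * h s)" by auto
  then obtain h where h: "\<And>l. l < e \<Longrightarrow> polyfun (h l)"
    and th: "\<And>l s. l < e \<Longrightarrow> t l s - lag e (x s) (d + l) = s ^ e * h l s"
    unfolding bchoice_iff by blast
  obtain c where c: "eventually (\<lambda>s. x s e + c * s ^ e \<noteq> 0) (at 0)"
    by (rule polyfun_nonzero_perturb[OF x])
  define y where "y s k = x s k + (if k = e then c * s ^ e else 0)" for s k
  have y: "polyfun (\<lambda>s. y s k)" for k
    unfolding y_def by (cases "k = e") (auto intro!: polyfun_intros x)
  have step: "lag e (y s) (d + l) - lag e (x s) (d + l) = s ^ e * (c * lag_slope e (x s) (y s) (d + l) e)" for s l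
  proof -
    have "lag e (y s) (d + l) - lag e (x s) (d + l) =
      (\<Sum>k=1..e. if k = e then lag_slope e (x s) (y s) (d + l) k * (c * s ^ e) else 0)"
      unfolding lag_diff by (intro sum.cong refl) (simp add: y_def)
    then show ?thesis using e by simp
  qed
  show ?thesis
  proof (rule that[of y "\<lambda>l s. h l s - c * lag_slope e (x s) (y s) (d + l) e"])
    show "y 0 = x0" using e by (intro ext) (simp add: y_def x_0)
    show "eventually (\<lambda>s. y s e \<noteq> 0) (at 0)" using c by (simp add: y_def)
    fix l assume l: "l < e"
    show "polyfun (\<lambda>s. h l s - c * lag_slope e (x s) (y s) (d + l) e)"
      by (intro polyfun_intros h l polyfun_lag_slope x y)
    show "t l s - lag e (y s) (d + l) = s ^ e * (h l s - c * lag_slope e (x s) (y s) (d + l) e)" for s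
    proof -
      have "t l s - lag e (y s) (d + l) = s ^ e * h l s - s ^ e * (c * lag_slope e (x s) (y s) (d + l) e)"
        using th[OF l, of s] step[of s l] by (simp add: diff_eq_eq algebra_simps)
      then show ?thesis by (simp only: right_diff_distrib)
    qed
  qed (rule y)
qed

definition cpoly :: "nat \<Rightarrow> (nat \<Rightarrow> complex) \<Rightarrow> complex poly" where
  "cpoly e x = (\<Sum>j\<le>Suc e. monom (if j = 0 then 0 else fps_nth (cseries e x) (j - 1)) j)"

lemma degree_cpoly: "degree (cpoly e x) \<le> Suc e"
  unfolding cpoly_def by (rule degree_sum_monom)

lemma coeff_cpoly: "coeff (cpoly e x) j = (if j = 0 then 0 else fps_nth (cseries e x) (j - 1))"
  unfolding cpoly_def coeff_sum_monom by (auto simp: cseries_nth)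

lemma fps_of_poly_cpoly: "fps_of_poly (cpoly e x) = fps_X * cseries e x"
  by (rule fps_ext) (simp add: coeff_cpoly)

lemma poly_cpoly: "poly (cpoly e x) z = z * (\<Sum>k\<le>e. fps_nth (cseries e x) k * z ^ k)"
  unfolding cpoly_def poly_sum_monom unfolding sum.atMost_Suc_shift
  by (simp add: sum_distrib_left mult_ac)

text \<open>The truncated inverse composed with \<open>p\<close> differs from the identity only in
  degrees above \<open>n\<close>, so substituting \<open>s * y\<close> produces the factor
  \<open>s^(n+1)\<close>. The quotient is polynomial in \<open>s\<close> because all coefficients
  are.\<close>

lemma lag_remainder:
  assumes x: "\<And>k. polyfun (\<lambda>s. x s k)"
  obtains w where "polyfun w"
    "\<And>s. (\<Sum>j<n. lag e (x s) j * poly (cpoly e (x s)) (s * y) ^ Suc j) - s * y = s ^ Suc n * w s"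
proof -
  define E where "E s = (\<Sum>j<n. smult (lag e (x s) j) (cpoly e (x s) ^ Suc j)) - [:0, 1:]" for s
  \<comment> \<open>A degree bound independent of \<open>s\<close>: \<open>n * Suc e\<close> for the
    powers of \<open>p\<close>, and 1 for the subtracted identity.\<close>
  define D where "D = max 1 (n * Suc e)"
  have fps: "fps_of_poly (E s) =
      (\<Sum>j<n. fps_const (lag e (x s) j) * (fps_X * cseries e (x s)) ^ Suc j) - fps_X" for s
    unfolding E_def
    by (simp add: fps_of_poly_diff fps_of_poly_sum fps_of_poly_smult fps_of_poly_power fps_of_poly_cpoly
        fps_of_poly_fps_X del: power_Suc)
  have pf: "polyfps (\<lambda>s. \<Sum>j<n. fps_const (lag e (x s) j) * (fps_X * cseries e (x s)) ^ Suc j)"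
  proof (intro polyfps_sum polyfps_mult polyfps_power polyfps_cseries x)
    show "polyfps (\<lambda>s. fps_const (lag e (x s) j))" for j
    proof (unfold polyfps_def, intro allI)
      show "polyfun (\<lambda>s. fps_nth (fps_const (lag e (x s) j)) m)" for m
        by (cases "m = 0") (auto intro: polyfun_intros polyfun_lag x)
    qed
    show "polyfps (\<lambda>s. fps_X)" unfolding polyfps_def by (auto intro: polyfun_intros)
  qed
  have coeff: "coeff (E s) m = fps_nth (\<Sum>j<n. fps_const (lag e (x s) j) * (fps_X * cseries e (x s)) ^ Suc j) m
      - fps_nth fps_X m" for s m
    unfolding fps_of_poly_nth[symmetric] fps by simp
  have E_poly: "polyfun (\<lambda>s. coeff (E s) m)" for m
    unfolding coeff using pf unfolding polyfps_def by (intro polyfun_diff polyfun_const) blast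
  have E_0: "coeff (E s) m = 0" if "m \<le> n" for s m
    unfolding coeff lag_compose_nth[OF that] by simp
  have "degree (cpoly e (x s) ^ Suc j) \<le> D" if "j < n" for s j
  proof -
    have "degree (cpoly e (x s) ^ Suc j) \<le> degree (cpoly e (x s)) * Suc j" by (rule degree_power_le)
    also have "\<dots> \<le> Suc e * n" using that degree_cpoly by (intro mult_le_mono) auto
    finally show ?thesis by (simp add: D_def mult.commute)
  qed
  then have deg: "degree (E s) \<le> D" for s
    unfolding E_def by (intro degree_diff_le degree_sum_le) (auto simp: D_def intro: order.trans[OF degree_smult_le])
  define w where "w s = (\<Sum>m\<in>{Suc n..D}. coeff (E s) m * s ^ (m - Suc n) * y ^ m)" for s
  have "(\<Sum>j<n. lag e (x s) j * poly (cpoly e (x s)) (s * y) ^ Suc j) - s * y = s ^ Suc n * w s" for s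
  proof -
    have "(\<Sum>j<n. lag e (x s) j * poly (cpoly e (x s)) (s * y) ^ Suc j) - s * y = poly (E s) (s * y)"
      unfolding E_def by (simp add: poly_sum del: power_Suc)
    also have "\<dots> = (\<Sum>m\<le>D. coeff (E s) m * (s * y) ^ m)"
      by (subst poly_as_sum_of_monoms'[OF deg, symmetric]) (rule poly_sum_monom)
    also have "\<dots> = (\<Sum>m\<in>{Suc n..D}. coeff (E s) m * (s * y) ^ m)"
      by (rule sum.mono_neutral_right) (auto simp: E_0)
    also have "\<dots> = s ^ Suc n * w s"
      unfolding w_def sum_distrib_left
    proof (intro sum.cong refl)
      fix m assume "m \<in> {Suc n..D}"
      then have "s ^ m = s ^ Suc n * s ^ (m - Suc n)" by (metis atLeastAtMost_iff le_add_diff_inverse power_add)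
      then show "coeff (E s) m * (s * y) ^ m = s ^ Suc n * (coeff (E s) m * s ^ (m - Suc n) * y ^ m)"
        by (simp add: power_mult_distrib mult_ac del: power_Suc)
    qed
    finally show ?thesis .
  qed
  moreover have "polyfun w" unfolding w_def by (intro polyfun_intros E_poly)
  ultimately show ?thesis using that by blast
qed

text \<open>Both numerators are a power of \<open>s\<close> times a polynomial function of
  \<open>s\<close>, so the limits are values at 0. The degree bounds are stated for every
  \<open>s\<close>, the exact degrees near 0.\<close>

lemma degeneration:
  fixes R :: "complex poly"
  assumes d: "d \<ge> 2" and e: "e \<ge> 1" and R: "degree R = d + e"
    and M: "\<And>l m. l < e \<Longrightarrow> m < e \<Longrightarrow>
      (\<Sum>i<e. lag_slope e x0 x0 (d + l) (Suc i) * M i m) = (if l = m then 1 else 0)"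
    and zero: "\<And>i. i + 2 \<le> e \<Longrightarrow> lag e x0 (d + i) = 0"
    and nonzero: "lag e x0 (d + e - 1) \<noteq> 0"
  obtains \<rho> p Q where "\<rho> \<noteq> 0" "\<And>s. degree (p s) \<le> Suc e" "\<And>s. degree (Q s) \<le> d"
    "eventually (\<lambda>s. degree (p s) = Suc e \<and> degree (Q s) = d) (at 0)"
    "\<And>x y. ((\<lambda>s. (poly (Q s) (\<rho> * s ^ (d + e) * x + poly (p s) (s * y)) - s * y) / (\<rho> * s ^ (d + e)))
       \<longlongrightarrow> x + poly R y) (at 0)"
    "\<And>x y. ((\<lambda>s. (\<rho> * s ^ (d + e) * x + poly (p s) (s * y)) / s) \<longlongrightarrow> y) (at 0)"
proof -
  define n where "n = d + e"
  have Rn: "coeff R n \<noteq> 0" using R d unfolding n_def by (metis leading_coeff_0_iff degree_0 add_is_0 not_numeral_le_zero)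
  \<comment> \<open>Forced by the target for \<open>l = e - 1\<close>, which carries
    \<open>s^0\<close> and has to equal g_(d+e-1) at \<open>x0\<close>.\<close>
  define \<rho> where "\<rho> = - lag e x0 (n - 1) / coeff R n"
  have \<rho>: "\<rho> \<noteq> 0" using nonzero Rn by (simp add: \<rho>_def n_def)
  \<comment> \<open>The exponent is chosen so that \<open>t l s * s^(d+l+1)\<close> is - \<rho>
    R_(d+l+1) s^n. At \<open>s = 0\<close> only \<open>l = e - 1\<close> survives, in accordance
    with the values at \<open>x0\<close>.\<close>
  define t where "t l s = - \<rho> * coeff R (Suc (d + l)) * s ^ (e - Suc l)" for l and s :: complex
  have t: "polyfun (t l)" for l unfolding t_def by (intro polyfun_intros)
  have t0: "t l 0 = lag e x0 (d + l)" if l: "l < e" for l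
  proof (cases "Suc l = e")
    case True
    then have "Suc (d + l) = n" "d + l = n - 1" by (auto simp: n_def)
    then show ?thesis using True Rn by (simp add: t_def \<rho>_def)
  next
    case False
    then show ?thesis using l zero[of l] by (simp add: t_def)
  qed
  obtain x h where x: "\<And>k. polyfun (\<lambda>s. x s k)" and x_0: "x 0 = x0"
    and xe: "eventually (\<lambda>s. x s e \<noteq> 0) (at 0)" and h: "\<And>l. l < e \<Longrightarrow> polyfun (h l)"
    and th: "\<And>l s. l < e \<Longrightarrow> t l s - lag e (x s) (d + l) = s ^ e * h l s"
    using lag_curve_nonzero[of e x0 d M t, OF e M t t0] by blast
  \<comment> \<open>The coefficient of Z^j in \<open>Q\<close>, before perturbation. The inverse
    series contributes \<open>lag\<close> with index \<open>j - 1\<close>; the other summand becomes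
    \<rho> R_j s^n Y^j when Z is replaced by s Y.\<close>
  define q' where "q' s j = (if j = 0 then 0 else lag e (x s) (j - 1)) + \<rho> * coeff R j * s ^ (n - j)" for s j
  have q': "polyfun (\<lambda>s. q' s j)" for j
    unfolding q'_def by (cases "j = 0") (auto intro!: polyfun_intros polyfun_lag x)
  obtain c where c: "eventually (\<lambda>s. q' s d + c * s ^ Suc e \<noteq> 0) (at 0)"
    by (rule polyfun_nonzero_perturb[OF q'])
  \<comment> \<open>With Z = s Y the perturbation has order \<open>s^(e+1) * s^d = s^(n+1)\<close>:
    it disappears in the limit but gives \<open>Q\<close> the exact degree \<open>d\<close> near
    0.\<close>
  define q where "q s j = q' s j + (if j = d then c * s ^ Suc e else 0)" for s j
  have q: "polyfun (\<lambda>s. q s j)" for j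
    unfolding q_def by (cases "j = d") (auto intro!: polyfun_intros q')
  define p where "p s = cpoly e (x s)" for s
  define Q where "Q s = (\<Sum>j\<le>d. monom (q s j) j)" for s
  have "eventually (\<lambda>s. degree (p s) = Suc e \<and> degree (Q s) = d) (at 0)"
    using xe c
  proof eventually_elim
    case (elim s)
    have "coeff (p s) (Suc e) \<noteq> 0" using elim e by (simp add: p_def coeff_cpoly cseries_nth)
    moreover have "coeff (Q s) d \<noteq> 0" using elim by (simp add: Q_def coeff_sum_monom q_def)
    ultimately show ?case
      unfolding p_def Q_def by (intro conjI antisym degree_cpoly degree_sum_monom le_degree)
  qed
  moreover have "((\<lambda>s. (\<rho> * s ^ n * a + poly (p s) (s * b)) / s) \<longlongrightarrow> b) (at 0) \<and>
    ((\<lambda>s. (poly (Q s) (\<rho> * s ^ n * a + poly (p s) (s * b)) - s * b) / (\<rho> * s ^ n)) \<longlongrightarrow> a + poly R b) (at 0)"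
    for a b
  proof -
    \<comment> \<open>This is \<open>poly (p s) (s * b) / s\<close>, written so that it makes sense
      at \<open>s = 0\<close>.\<close>
    define Y where "Y s = b * (\<Sum>k\<le>e. fps_nth (cseries e (x s)) k * (s * b) ^ k)" for s
    have "polyfun (\<lambda>s. fps_nth (cseries e (x s)) k)" for k
      using polyfps_cseries[of x e, OF x] by (simp add: polyfps_def)
    then have Y: "polyfun Y" unfolding Y_def by (intro polyfun_intros)
    have Y_0: "Y 0 = b"
    proof -
      have "(\<Sum>k\<le>e. fps_nth (cseries e (x 0)) k * (0 * b) ^ k) = (\<Sum>k\<in>{0}. fps_nth (cseries e (x 0)) k * (0 * b) ^ k)"
        by (rule sum.mono_neutral_right) auto
      then show ?thesis unfolding Y_def by (simp add: cseries_nth)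
    qed
    have pY: "poly (p s) (s * b) = s * Y s" for s
      unfolding p_def poly_cpoly Y_def by (simp only: mult_ac)
    define U where "U s = \<rho> * s ^ (n - 1) * a + Y s" for s
    have U: "polyfun U" unfolding U_def by (intro polyfun_intros Y)
    have n2: "n - 1 \<noteq> 0" "n \<noteq> 0" using d by (auto simp: n_def)
    have U_0: "U 0 = b" using n2 by (simp add: U_def Y_0)
    have "s ^ n = s * s ^ (n - 1)" for s :: complex using n2 by (cases n) simp_all
    then have u: "\<rho> * s ^ n * a + poly (p s) (s * b) = s * U s" for s
      unfolding pY U_def by (simp add: algebra_simps)
    \<comment> \<open>The divided difference of \<open>Q s\<close> between \<open>s * U s\<close>
      and \<open>s * Y s\<close>. At \<open>s = 0\<close> both points are 0, so \<open>D 0\<close>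
      is the linear coefficient of \<open>Q 0\<close>.\<close>
    define D where "D s = (\<Sum>j\<le>d. q s j * (\<Sum>i<j. (s * Y s) ^ (j - Suc i) * (s * U s) ^ i))" for s
    have D: "polyfun D" unfolding D_def by (intro polyfun_intros q Y U)
    \<comment> \<open>Because \<open>d \<noteq> 1\<close>, the perturbation does not touch the
      linear coefficient; the summand with \<open>s^(n-1)\<close> vanishes at 0, and
      \<open>lag\<close> with index 0 is 1.\<close>
    have q1: "q 0 1 = 1"
    proof -
      have "n - 1 \<noteq> 0" "d \<noteq> 1" using n2 d by auto
      then show ?thesis by (simp add: q_def q'_def x_0 lag_def cseries_nth)
    qed
    have D_0: "D 0 = 1"
    proof -
      have "(\<Sum>i<j. (0 * Y 0) ^ (j - Suc i) * (0 * U 0) ^ i) = (if j = 1 then 1 else 0)" for j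
      proof (cases j)
        case (Suc k)
        have "(\<Sum>i<Suc k. (0 * Y 0) ^ (j - Suc i) * (0 * U 0) ^ i) = (\<Sum>i\<in>{0}. (0 * Y 0) ^ (j - Suc i) * (0 * U 0) ^ i)"
          by (rule sum.mono_neutral_right) auto
        then show ?thesis using Suc by simp
      qed simp
      then have "D 0 = (\<Sum>j\<le>d. if j = 1 then q 0 1 else 0)"
        unfolding D_def by (intro sum.cong refl) auto
      then show ?thesis using d q1 by simp
    qed
    have QQ: "poly (Q s) (s * U s) - poly (Q s) (s * Y s) = \<rho> * s ^ n * a * D s" for s
    proof -
      have "poly (Q s) (s * U s) - poly (Q s) (s * Y s) = (\<Sum>j\<le>d. q s j * ((s * U s) ^ j - (s * Y s) ^ j))"
        unfolding Q_def poly_sum_monom by (simp add: sum_subtractf algebra_simps)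
      also have "\<dots> = (s * U s - s * Y s) * D s"
        unfolding D_def
        by (subst sum_distrib_left, intro sum.cong refl, unfold power_diff_sumr2) (simp only: mult_ac)
      also have "s * U s - s * Y s = \<rho> * s ^ n * a"
        using u[of s] unfolding pY by (simp add: algebra_simps)
      finally show ?thesis .
    qed
    obtain w where w: "polyfun w"
      and "\<And>s. (\<Sum>j<n. lag e (x s) j * poly (cpoly e (x s)) (s * b) ^ Suc j) - s * b = s ^ Suc n * w s"
      by (rule lag_remainder[where x = x and n = n and e = e and y = b, OF x]) blast
    then have rem: "(\<Sum>j<n. lag e (x s) j * (s * Y s) ^ Suc j) - s * b = s ^ Suc n * w s" for s
      unfolding p_def[symmetric] pY by simp
    \<comment> \<open>The quotient of \<open>poly (Q s) (s * Y s) - s * b\<close> by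
      \<open>s^n\<close>. Its parts come from the truncation remainder, from the indices above
      \<open>d\<close> that \<open>Q\<close> omits, from the terms of \<open>R\<close> inserted into
      \<open>Q\<close>, and from the perturbation.\<close>
    define V where "V s = s * w s + (\<Sum>l<e. (\<rho> * coeff R (Suc (d + l)) + s ^ Suc l * h l s) * Y s ^ Suc (d + l))
      + (\<Sum>j\<le>d. \<rho> * coeff R j * Y s ^ j) + s * (c * Y s ^ d)" for s
    have V: "polyfun V" unfolding V_def by (intro polyfun_intros w h Y) auto
    have V_0: "V 0 = \<rho> * poly R b"
    proof -
      have "poly R b = (\<Sum>j\<le>d + e. coeff R j * b ^ j)" by (simp add: poly_altdef R)
      also have "\<dots> = (\<Sum>j\<le>d. coeff R j * b ^ j) + (\<Sum>l<e. coeff R (Suc (d + l)) * b ^ Suc (d + l))"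
        using sum_lessThan_add[of "\<lambda>j. coeff R j * b ^ j" "Suc d" e]
        by (simp only: lessThan_Suc_atMost[symmetric] add_Suc)
      finally show ?thesis
        unfolding V_def by (simp add: Y_0 sum_distrib_left algebra_simps del: power_Suc)
    qed
    have QY: "poly (Q s) (s * Y s) - s * b = s ^ n * V s" for s
    proof -
      have split: "(\<Sum>j<n. lag e (x s) j * (s * Y s) ^ Suc j) =
          (\<Sum>j<d. lag e (x s) j * (s * Y s) ^ Suc j) + (\<Sum>l<e. lag e (x s) (d + l) * (s * Y s) ^ Suc (d + l))"
        unfolding n_def by (rule sum_lessThan_add)
      have A: "(\<Sum>j\<le>d. (if j = 0 then 0 else lag e (x s) (j - 1)) * (s * Y s) ^ j) = (\<Sum>j<d. lag e (x s) j * (s * Y s) ^ Suc j)"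
        unfolding sum.atMost_shift by simp
      have B: "(\<Sum>j\<le>d. \<rho> * coeff R j * s ^ (n - j) * (s * Y s) ^ j) = s ^ n * (\<Sum>j\<le>d. \<rho> * coeff R j * Y s ^ j)"
        unfolding sum_distrib_left
      proof (intro sum.cong refl)
        fix j assume "j \<in> {..d}"
        then have "s ^ n = s ^ (n - j) * s ^ j" by (simp add: n_def flip: power_add)
        then show "\<rho> * coeff R j * s ^ (n - j) * (s * Y s) ^ j = s ^ n * (\<rho> * coeff R j * Y s ^ j)"
          by (simp add: power_mult_distrib mult_ac)
      qed
      have C: "(\<Sum>j\<le>d. (if j = d then c * s ^ Suc e else 0) * (s * Y s) ^ j) = s ^ n * (s * (c * Y s ^ d))"
      proof -
        have "(\<Sum>j\<le>d. (if j = d then c * s ^ Suc e else 0) * (s * Y s) ^ j) =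
            (\<Sum>j\<le>d. if j = d then s ^ n * (s * (c * Y s ^ d)) else 0)"
          by (intro sum.cong refl) (simp add: power_mult_distrib n_def power_add mult_ac)
        then show ?thesis by simp
      qed
      \<comment> \<open>The omitted terms enter \<open>V\<close> with a minus sign, which cancels
        the sign in \<open>t\<close>.\<close>
      have E: "(\<Sum>l<e. lag e (x s) (d + l) * (s * Y s) ^ Suc (d + l)) =
          - (s ^ n * (\<Sum>l<e. (\<rho> * coeff R (Suc (d + l)) + s ^ Suc l * h l s) * Y s ^ Suc (d + l)))"
        unfolding sum_distrib_left sum_negf[symmetric]
      proof (intro sum.cong refl)
        fix l assume "l \<in> {..<e}"
        then have l: "l < e" by simp
        have lag: "lag e (x s) (d + l) = t l s - s ^ e * h l s" using th[OF l, of s] by (simp add: algebra_simps)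
        have p1: "s ^ n = s ^ (e - Suc l) * s ^ Suc (d + l)"
          unfolding power_add[symmetric] by (rule arg_cong[of _ _ "power s"]) (use l in \<open>simp add: n_def\<close>)
        have p2: "s ^ e * s ^ Suc (d + l) = s ^ n * s ^ Suc l"
          unfolding power_add[symmetric] by (rule arg_cong[of _ _ "power s"]) (simp add: n_def)
        have "lag e (x s) (d + l) * (s * Y s) ^ Suc (d + l) =
            (- \<rho> * coeff R (Suc (d + l)) * (s ^ (e - Suc l) * s ^ Suc (d + l)) - (s ^ e * s ^ Suc (d + l)) * h l s) * Y s ^ Suc (d + l)"
          unfolding lag t_def power_mult_distrib by (simp add: algebra_simps del: power_Suc)
        also have "\<dots> = - (s ^ n * ((\<rho> * coeff R (Suc (d + l)) + s ^ Suc l * h l s) * Y s ^ Suc (d + l)))"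
          unfolding p1[symmetric] p2 by (simp add: algebra_simps del: power_Suc)
        finally show "lag e (x s) (d + l) * (s * Y s) ^ Suc (d + l) = \<dots>" .
      qed
      have "poly (Q s) (s * Y s) = (\<Sum>j<d. lag e (x s) j * (s * Y s) ^ Suc j) + s ^ n * (\<Sum>j\<le>d. \<rho> * coeff R j * Y s ^ j) + s ^ n * (s * (c * Y s ^ d))"
        unfolding Q_def poly_sum_monom q_def q'_def distrib_right sum.distrib A B C ..
      then show ?thesis
        using rem[of s] unfolding split E V_def by (simp add: algebra_simps del: power_Suc) (simp add: algebra_simps)
    qed
    have lim1: "((\<lambda>s. (\<rho> * s ^ n * a + poly (p s) (s * b)) / s) \<longlongrightarrow> b) (at 0)"
    proof (rule Lim_transform_eventually)
      show "(U \<longlongrightarrow> b) (at 0)" using polyfun_tendsto[OF U, of 0] by (simp add: U_0)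
      show "eventually (\<lambda>s. U s = (\<rho> * s ^ n * a + poly (p s) (s * b)) / s) (at 0)"
        unfolding u by (simp add: eventually_at_filter)
    qed
    have lim2: "((\<lambda>s. (poly (Q s) (\<rho> * s ^ n * a + poly (p s) (s * b)) - s * b) / (\<rho> * s ^ n)) \<longlongrightarrow> a + poly R b) (at 0)"
    proof (rule Lim_transform_eventually)
      have "polyfun (\<lambda>s. a * D s + V s / \<rho>)" by (intro polyfun_intros D V)
      from polyfun_tendsto[OF this, of 0] show "((\<lambda>s. a * D s + V s / \<rho>) \<longlongrightarrow> a + poly R b) (at 0)"
        using \<rho> by (simp add: D_0 V_0)
      have "a * D s + V s / \<rho> = (poly (Q s) (s * U s) - s * b) / (\<rho> * s ^ n)" if "s \<noteq> 0" for s
      proof -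
        have "poly (Q s) (s * U s) - s * b = \<rho> * s ^ n * a * D s + s ^ n * V s"
          using QQ[of s] QY[of s] by (simp add: algebra_simps)
        then show ?thesis using that \<rho> by (simp add: field_simps)
      qed
      then show "eventually (\<lambda>s. a * D s + V s / \<rho> = (poly (Q s) (\<rho> * s ^ n * a + poly (p s) (s * b)) - s * b) / (\<rho> * s ^ n)) (at 0)"
        unfolding u by (simp add: eventually_at_filter)
    qed
    show ?thesis using lim1 lim2 by blast
  qed
  moreover have "degree (p s) \<le> Suc e" "degree (Q s) \<le> d" for s
    unfolding p_def Q_def by (rule degree_cpoly degree_sum_monom)+
  ultimately show ?thesis using that[of \<rho> p Q] \<rho> unfolding n_def by blast
qed


section \<open>Evaluation and convergence of polynomial maps\<close>

text \<open>The symbol also denotes \<^const>\<open>pcomp\<close>.\<close>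

no_notation pcompose (infixl \<open>\<circ>\<^sub>p\<close> 71)

lemma poly_map_poly:
  fixes \<phi> :: "'a :: zero \<Rightarrow> 'b :: comm_semiring_1"
  assumes "\<phi> 0 = 0"
  shows "poly (map_poly \<phi> P) g = (\<Sum>i\<le>degree P. \<phi> (coeff P i) * g ^ i)"
proof -
  have "degree (map_poly \<phi> P) \<le> degree P"
    using assms by (intro degree_le) (simp add: coeff_map_poly coeff_eq_0)
  moreover have "\<phi> (coeff P i) = 0" if "degree (map_poly \<phi> P) < i" for i
    using coeff_eq_0[OF that] assms by (simp add: coeff_map_poly)
  ultimately have "(\<Sum>i\<le>degree (map_poly \<phi> P). \<phi> (coeff P i) * g ^ i) = (\<Sum>i\<le>degree P. \<phi> (coeff P i) * g ^ i)"
    by (intro sum.mono_neutral_left) auto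
  then show ?thesis using assms by (simp add: poly_altdef coeff_map_poly)
qed

text \<open>Values determine a polynomial over the complex numbers, so identities between polynomial
  maps reduce to identities between numbers, which simplification proves.\<close>

definition bev :: "bpoly \<Rightarrow> complex \<Rightarrow> complex \<Rightarrow> complex" where
  "bev F x y = poly (poly F [:y:]) x"

lemma bev_add [simp]: "bev (F + G) x y = bev F x y + bev G x y"
  and bev_minus [simp]: "bev (- F) x y = - bev F x y"
  and bev_diff [simp]: "bev (F - G) x y = bev F x y - bev G x y"
  and bev_mult [simp]: "bev (F * G) x y = bev F x y * bev G x y"
  and bev_power [simp]: "bev (F ^ n) x y = bev F x y ^ n"
  and bev_0 [simp]: "bev 0 x y = 0"
  and bev_1 [simp]: "bev 1 x y = 1"
  and bev_bX [simp]: "bev bX x y = x"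
  and bev_bY [simp]: "bev bY x y = y"
  and bev_bconst [simp]: "bev (bconst c) x y = c"
  by (simp_all add: bev_def bX_def bY_def bconst_def)

lemma bev_sum [simp]: "bev (sum f I) x y = (\<Sum>i\<in>I. bev (f i) x y)"
  by (induction I rule: infinite_finite_induct) simp_all

lemma bev_poly_in_Y [simp]: "bev (poly_in_Y P) x y = poly P y"
  unfolding bev_def poly_in_Y_def
  by (simp add: poly_map_poly poly_sum poly_const_pow poly_altdef[of P] mult.commute)

lemma bsubst_sum:
  "bsubst F G = (\<Sum>j\<le>degree F. (\<Sum>i\<le>degree (coeff F j).
     bconst (coeff (coeff F j) i) * fst G ^ i) * snd G ^ j)"
proof -
  have "bconst 0 = 0" by (simp add: bconst_def)
  then show ?thesis unfolding bsubst_def by (simp add: poly_map_poly)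
qed

lemma bev_sum_coeffs:
  "bev F x y = (\<Sum>j\<le>degree F. (\<Sum>i\<le>degree (coeff F j). coeff (coeff F j) i * x ^ i) * y ^ j)"
  unfolding bev_def poly_altdef[of F] poly_sum poly_mult poly_power
  by (intro sum.cong refl) (simp add: poly_altdef)

lemma bev_bsubst [simp]: "bev (bsubst F G) x y = bev F (bev (fst G) x y) (bev (snd G) x y)"
  unfolding bsubst_sum by (simp add: bev_sum_coeffs[of F])

text \<open>Over the domain C[X] the difference \<open>F - G\<close> is a polynomial in Y having all
  complex constants as roots.\<close>

lemma bpoly_eqI:
  assumes "\<And>x y. bev F x y = bev G x y"
  shows "F = G"
proof -
  have "poly (F - G) [:y:] = 0" for y
  proof -
    have "poly F [:y:] = poly G [:y:]"
      by (rule poly_eq_poly_eq_iff[THEN iffD1]) (use assms in \<open>auto simp: bev_def\<close>)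
    then show ?thesis by simp
  qed
  then have "range (\<lambda>y. [:y:]) \<subseteq> {p. poly (F - G) p = 0}" by auto
  moreover have "infinite (range (\<lambda>y :: complex. [:y:]))"
    by (simp add: finite_image_iff inj_on_def infinite_UNIV_char_0)
  ultimately have "F - G = 0"
    using poly_roots_finite finite_subset by blast
  then show ?thesis by simp
qed

lemma pmap_eqI:
  assumes "\<And>x y. bev (fst F) x y = bev (fst G) x y" "\<And>x y. bev (snd F) x y = bev (snd G) x y"
  shows "F = G"
  using assms by (intro prod_eqI bpoly_eqI)

lemma bev_pcomp [simp]:
  "bev (fst (F \<circ>\<^sub>p G)) x y = bev (fst F) (bev (fst G) x y) (bev (snd G) x y)"
  "bev (snd (F \<circ>\<^sub>p G)) x y = bev (snd F) (bev (fst G) x y) (bev (snd G) x y)"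
  by (simp_all add: pcomp_def)

lemma pcomp_assoc: "F \<circ>\<^sub>p G \<circ>\<^sub>p H = F \<circ>\<^sub>p (G \<circ>\<^sub>p H)"
  by (rule pmap_eqI) simp_all

lemma pcomp_pid [simp]: "F \<circ>\<^sub>p pid = F" "pid \<circ>\<^sub>p F = F"
  by (rule pmap_eqI; simp add: pid_def)+

lemma pcomp_Aut:
  assumes "F \<in> Aut" "G \<in> Aut"
  shows "F \<circ>\<^sub>p G \<in> Aut"
proof -
  obtain F' G' where "F \<circ>\<^sub>p F' = pid" "F' \<circ>\<^sub>p F = pid" "G \<circ>\<^sub>p G' = pid" "G' \<circ>\<^sub>p G = pid"
    using assms by (auto simp: Aut_def)
  then have "(F \<circ>\<^sub>p G) \<circ>\<^sub>p (G' \<circ>\<^sub>p F') = pid" "(G' \<circ>\<^sub>p F') \<circ>\<^sub>p (F \<circ>\<^sub>p G) = pid"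
    by (metis pcomp_assoc pcomp_pid(1))+
  then show ?thesis unfolding Aut_def by blast
qed

section \<open>Total degree under sums, products and composition\<close>

lemma bdegree_le_iff:
  "bdegree F \<le> n \<longleftrightarrow> (\<forall>i j. coeff (coeff F j) i \<noteq> 0 \<longrightarrow> i + j \<le> n)"
  unfolding bdegree_def using finite_bpoly_support[of F] by auto

lemma bdegree_leI: "(\<And>i j. coeff (coeff F j) i \<noteq> 0 \<Longrightarrow> i + j \<le> n) \<Longrightarrow> bdegree F \<le> n"
  by (simp add: bdegree_le_iff)

lemma bdegreeD: "bdegree F \<le> n \<Longrightarrow> coeff (coeff F j) i \<noteq> 0 \<Longrightarrow> i + j \<le> n"
  by (simp add: bdegree_le_iff)

lemma bdegree_bconst: "bdegree (bconst c) \<le> 0"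
  by (rule bdegree_leI) (auto simp: bconst_def coeff_pCons split: nat.splits if_splits)

lemma bdegree_bX: "bdegree bX \<le> 1"
  by (rule bdegree_leI) (auto simp: bX_def coeff_pCons split: nat.splits if_splits)

lemma bdegree_bY: "bdegree bY \<le> 1"
  by (rule bdegree_leI) (auto simp: bY_def coeff_pCons split: nat.splits if_splits)

lemma bdegree_poly_in_Y: "bdegree (poly_in_Y P) = degree P"
proof (rule antisym)
  have c: "coeff (coeff (poly_in_Y P) j) i = (if i = 0 then coeff P j else 0)" for i j
    by (auto simp: poly_in_Y_def coeff_map_poly coeff_pCons split: nat.splits)
  show "bdegree (poly_in_Y P) \<le> degree P"
    by (rule bdegree_leI) (auto simp: c le_degree split: if_splits)
  show "degree P \<le> bdegree (poly_in_Y P)"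
  proof (cases "P = 0")
    case False
    then show ?thesis
      using bdegreeD[of "poly_in_Y P" "bdegree (poly_in_Y P)" "degree P" 0] by (simp add: c)
  qed simp
qed

lemma bdegree_add:
  assumes "bdegree F \<le> n" "bdegree G \<le> n"
  shows "bdegree (F + G) \<le> n"
proof (rule bdegree_leI)
  fix i j assume "coeff (coeff (F + G) j) i \<noteq> 0"
  then have "coeff (coeff F j) i \<noteq> 0 \<or> coeff (coeff G j) i \<noteq> 0" by auto
  then show "i + j \<le> n" using assms bdegreeD by blast
qed

lemma bdegree_sum: "(\<And>i. i \<in> I \<Longrightarrow> bdegree (f i) \<le> n) \<Longrightarrow> bdegree (sum f I) \<le> n"
proof (induction I rule: infinite_finite_induct)
  case (insert i I)
  then show ?case by (simp add: bdegree_add)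
qed (simp_all add: bdegree_le_iff)

lemma bdegree_mult:
  assumes F: "bdegree F \<le> m" and G: "bdegree G \<le> n"
  shows "bdegree (F * G) \<le> m + n"
proof (rule bdegree_leI)
  fix i j assume "coeff (coeff (F * G) j) i \<noteq> 0"
  then have "(\<Sum>k\<le>j. \<Sum>l\<le>i. coeff (coeff F k) l * coeff (coeff G (j - k)) (i - l)) \<noteq> 0"
    by (simp add: coeff_mult coeff_sum)
  then obtain k l where kl: "k \<le> j" "l \<le> i" "coeff (coeff F k) l * coeff (coeff G (j - k)) (i - l) \<noteq> 0"
    by (metis (no_types, lifting) atMost_iff sum.neutral)
  then have "l + k \<le> m" "(i - l) + (j - k) \<le> n"
    using bdegreeD[OF F, of k l] bdegreeD[OF G, of "j - k" "i - l"] by auto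
  then show "i + j \<le> m + n" using kl by linarith
qed

lemma bdegree_power: "bdegree F \<le> m \<Longrightarrow> bdegree (F ^ n) \<le> n * m"
proof (induction n)
  case 0
  show ?case using bdegree_bconst[of 1] by (simp add: bconst_def flip: one_pCons)
next
  case (Suc n)
  then show ?case using bdegree_mult[of F m "F ^ n" "n * m"] by simp
qed

lemma bdegree_bsubst:
  assumes F: "bdegree F \<le> m" and G: "pdegree G \<le> n"
  shows "bdegree (bsubst F G) \<le> m * n"
  unfolding bsubst_sum sum_distrib_right
proof (intro bdegree_sum)
  fix i j
  show "bdegree (bconst (coeff (coeff F j) i) * fst G ^ i * snd G ^ j) \<le> m * n"
  proof (cases "coeff (coeff F j) i = 0")
    case True
    then show ?thesis by (simp add: bconst_def bdegree_le_iff)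
  next
    case False
    have "bdegree (fst G) \<le> n" "bdegree (snd G) \<le> n" using G by (simp_all add: pdegree_def)
    then have "bdegree (bconst (coeff (coeff F j) i) * fst G ^ i * snd G ^ j) \<le> 0 + i * n + j * n"
      by (intro bdegree_mult bdegree_power bdegree_bconst)
    also have "\<dots> = (i + j) * n" by (simp add: algebra_simps)
    also have "\<dots> \<le> m * n" using bdegreeD[OF F False] by (rule mult_le_mono1)
    finally show ?thesis .
  qed
qed

lemma pdegree_pcomp:
  assumes "pdegree F \<le> m" "pdegree G \<le> n"
  shows "pdegree (F \<circ>\<^sub>p G) \<le> m * n"
  using assms bdegree_bsubst[of _ m G n] by (simp add: pdegree_def pcomp_def)

text \<open>Induction on the degree bound. Subtracting the value at \<open>a\<close> and dividing by
  X - a lowers the degree; the quotient still converges at the other points of \<open>A\<close>, and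
  its coefficients together with the value at \<open>a\<close> recover the original ones.\<close>

lemma poly_coeff_tendsto:
  fixes p :: "'a \<Rightarrow> complex poly"
  assumes "infinite A" "\<And>s. degree (p s) \<le> n" "degree q \<le> n"
    and "\<And>x. x \<in> A \<Longrightarrow> ((\<lambda>s. poly (p s) x) \<longlongrightarrow> poly q x) F"
  shows "((\<lambda>s. coeff (p s) i) \<longlongrightarrow> coeff q i) F"
  using assms
proof (induction n arbitrary: A p q i)
  case 0
  obtain a where "a \<in> A" using 0(1) by (metis finite.emptyI ex_in_conv)
  have c: "coeff r i = (if i = 0 then poly r a else 0)" if "degree r \<le> 0" for r :: "complex poly"
    using that by (auto elim!: degree_eq_zeroE simp: coeff_pCons split: nat.splits)
  show ?case
    using 0(4)[OF \<open>a \<in> A\<close>] c[OF 0(2)] c[OF 0(3)] by simp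
next
  case (Suc n)
  obtain a where a: "a \<in> A" using Suc(2) by (metis finite.emptyI ex_in_conv)
  have div: "r = [:- a, 1:] * synthetic_div r a + [:poly r a:]" for r
    using synthetic_div_correct'[of a r] by simp
  have val: "poly (synthetic_div r a) x = (poly r x - poly r a) / (x - a)" if "x \<noteq> a" for r x
  proof -
    have "poly r x = (x - a) * poly (synthetic_div r a) x + poly r a"
      using arg_cong[OF div[of r], of "\<lambda>r. poly r x"] by (simp add: algebra_simps)
    then show ?thesis using that by (simp add: field_simps)
  qed
  have IH: "((\<lambda>s. coeff (synthetic_div (p s) a) i) \<longlongrightarrow> coeff (synthetic_div q a) i) F" for i
  proof (rule Suc.IH)
    show "infinite (A - {a})" using Suc(2) by simp
    show "degree (synthetic_div (p s) a) \<le> n" for s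
      using Suc(3)[of s] by (simp add: degree_synthetic_div)
    show "degree (synthetic_div q a) \<le> n"
      using Suc(4) by (simp add: degree_synthetic_div)
    show "((\<lambda>s. poly (synthetic_div (p s) a) x) \<longlongrightarrow> poly (synthetic_div q a) x) F" if "x \<in> A - {a}" for x
      using that a Suc(5)[of x] Suc(5)[of a] by (auto simp: val intro!: tendsto_intros)
  qed
  have coeff: "coeff r i = - a * coeff (synthetic_div r a) i +
      (case i of 0 \<Rightarrow> poly r a | Suc k \<Rightarrow> coeff (synthetic_div r a) k)" for r
    by (subst div[of r]) (simp add: coeff_pCons split: nat.split)
  show ?case
    unfolding coeff[of "p _"] coeff[of q]
  proof (intro tendsto_add tendsto_mult tendsto_const IH)
    show "((\<lambda>s. case i of 0 \<Rightarrow> poly (p s) a | Suc k \<Rightarrow> coeff (synthetic_div (p s) a) k) \<longlongrightarrow>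
      (case i of 0 \<Rightarrow> poly q a | Suc k \<Rightarrow> coeff (synthetic_div q a) k)) F"
      using Suc(5)[OF a] IH by (cases i) simp_all
  qed
qed

text \<open>The one variable case is used twice: in X for each fixed \<open>y\<close>, then in Y for
  the polynomial that collects the coefficients of X^i.\<close>

lemma bpoly_coeff_tendsto:
  fixes P :: "'a \<Rightarrow> bpoly"
  assumes P: "\<And>s. bdegree (P s) \<le> n" and Q: "bdegree Q \<le> n"
    and lim: "\<And>x y. ((\<lambda>s. bev (P s) x y) \<longlongrightarrow> bev Q x y) F"
  shows "((\<lambda>s. coeff (coeff (P s) j) i) \<longlongrightarrow> coeff (coeff Q j) i) F"
proof -
  have c: "coeff (poly R [:y:]) k = poly (map_poly (\<lambda>p. coeff p k) R) y" for R :: bpoly and y k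
  proof -
    have "poly R [:y:] = (\<Sum>j\<le>degree R. smult (y ^ j) (coeff R j))"
      unfolding poly_altdef by (intro sum.cong refl) (simp add: poly_const_pow)
    then show ?thesis by (simp add: poly_map_poly coeff_sum mult.commute)
  qed
  have degx: "degree (poly R [:y:]) \<le> n" if "bdegree R \<le> n" for R y
  proof (rule degree_le, intro allI impI)
    fix k assume "n < k"
    then have "coeff (coeff R j) k = 0" for j using bdegreeD[OF that, of j k] by fastforce
    then show "coeff (poly R [:y:]) k = 0" unfolding c by (simp add: poly_map_poly)
  qed
  have degy: "degree (map_poly (\<lambda>p. coeff p i) R) \<le> n" if "bdegree R \<le> n" for R
  proof (rule degree_le, intro allI impI)
    fix k assume "n < k"
    then show "coeff (map_poly (\<lambda>p. coeff p i) R) k = 0"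
      using bdegreeD[OF that, of k i] by (fastforce simp: coeff_map_poly)
  qed
  have "((\<lambda>s. coeff (poly (P s) [:y:]) i) \<longlongrightarrow> coeff (poly Q [:y:]) i) F" for y
    using lim unfolding bev_def
    by (intro poly_coeff_tendsto[where A = UNIV and n = n] degx P Q) (auto simp: infinite_UNIV_char_0)
  then have "((\<lambda>s. coeff (map_poly (\<lambda>p. coeff p i) (P s)) j) \<longlongrightarrow> coeff (map_poly (\<lambda>p. coeff p i) Q) j) F"
    unfolding c
    by (intro poly_coeff_tendsto[where A = UNIV and n = n] degy P Q) (auto simp: infinite_UNIV_char_0)
  then show ?thesis by (simp add: coeff_map_poly)
qed

text \<open>A closed set meets \<open>Aut_le n\<close> in the zeros of polynomials in the
  coefficients. If it contains \<open>A\<close>, these eventually vanish along the family, hence at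
  the limit by continuity. The closure is such a closed set.\<close>

lemma in_closure_ind_topology:
  assumes F: "F \<noteq> bot" and A: "eventually (\<lambda>s. \<sigma> s \<in> A) F" and "A \<subseteq> Aut"
    and deg: "\<And>s. pdegree (\<sigma> s) \<le> n" and \<theta>: "\<theta> \<in> Aut" "pdegree \<theta> \<le> n"
    and lim: "\<And>x y. ((\<lambda>s. bev (fst (\<sigma> s)) x y) \<longlongrightarrow> bev (fst \<theta>) x y) F"
      "\<And>x y. ((\<lambda>s. bev (snd (\<sigma> s)) x y) \<longlongrightarrow> bev (snd \<theta>) x y) F"
  shows "\<theta> \<in> ind_topology closure_of A"
proof -
  have "\<theta> \<in> C" if C: "ind_closed C" "A \<subseteq> C" for C
  proof -
    have "zariski_closed_le n (C \<inter> Aut_le n)" using C(1) by (auto simp: ind_closed_def)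
    then obtain S where S: "C \<inter> Aut_le n = {G \<in> Aut_le n. \<forall>p\<in>S. mp_eval (pcoeffs G) p = 0}"
      unfolding zariski_closed_le_def by auto
    have "mp_eval (pcoeffs \<theta>) p = 0" if p: "p \<in> S" for p
    proof -
      have "((\<lambda>s. coeff (coeff (fst (\<sigma> s)) j) i) \<longlongrightarrow> coeff (coeff (fst \<theta>) j) i) F"
        "((\<lambda>s. coeff (coeff (snd (\<sigma> s)) j) i) \<longlongrightarrow> coeff (coeff (snd \<theta>) j) i) F" for i j
        by (rule bpoly_coeff_tendsto[where n = n]; use deg \<theta>(2) lim in \<open>simp add: pdegree_def\<close>)+
      then have "((\<lambda>s. pcoeffs (\<sigma> s) v) \<longlongrightarrow> pcoeffs \<theta> v) F" for v
        unfolding pcoeffs_def by (auto split: sum.split)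
      then have "((\<lambda>s. mp_eval (pcoeffs (\<sigma> s)) p) \<longlongrightarrow> mp_eval (pcoeffs \<theta>) p) F"
        unfolding mp_eval_def by (intro tendsto_intros)
      moreover have "eventually (\<lambda>s. mp_eval (pcoeffs (\<sigma> s)) p = 0) F"
        using A
      proof (rule eventually_mono)
        fix s assume "\<sigma> s \<in> A"
        then have "\<sigma> s \<in> C \<inter> Aut_le n"
          using C(2) \<open>A \<subseteq> Aut\<close> deg by (auto simp: Aut_le_def)
        then show "mp_eval (pcoeffs (\<sigma> s)) p = 0" using p unfolding S by blast
      qed
      ultimately show ?thesis
        using F by (metis tendsto_unique tendsto_eventually)
    qed
    then have "\<theta> \<in> C \<inter> Aut_le n" using \<theta> unfolding S by (auto simp: Aut_le_def)
    then show ?thesis by blast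
  qed
  moreover have "A \<subseteq> ind_topology closure_of A"
    using \<open>A \<subseteq> Aut\<close> by (intro closure_of_subset) (simp add: topspace_ind_topology)
  moreover have "ind_closed (ind_topology closure_of A)"
    unfolding closedin_ind_topology[symmetric] by (rule closedin_closure_of)
  ultimately show ?thesis by blast
qed


section \<open>Polydegree of the family\<close>

text \<open>A map with constant first component has no right inverse. Since \<open>Affine\<close>
  asks for degree exactly 1, upper bounds then suffice to show membership.\<close>

lemma pdegree_ge_1:
  assumes "F \<in> Aut"
  shows "pdegree F \<ge> 1"
proof (rule ccontr)
  assume "\<not> pdegree F \<ge> 1"
  then have "bdegree (fst F) \<le> 0" by (simp add: pdegree_def)
  then have c: "coeff (coeff (fst F) j) i = 0" if "i + j \<noteq> 0" for i j
    using bdegreeD[of "fst F" 0 j i] that by auto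
  have "fst F = bconst (coeff (coeff (fst F) 0) 0)"
    by (intro poly_eqI) (auto simp: bconst_def coeff_pCons c split: nat.splits)
  then obtain a where a: "fst F = bconst a" by blast
  obtain G where "F \<circ>\<^sub>p G = pid" using assms by (auto simp: Aut_def)
  then have "bev (fst (F \<circ>\<^sub>p G)) x 0 = x" for x by (simp add: pid_def)
  then have "a = x" for x unfolding bev_pcomp a by simp
  from this[of 0] this[of 1] show False by simp
qed

lemma AffineI: "F \<in> Aut \<Longrightarrow> pdegree F \<le> 1 \<Longrightarrow> F \<in> Affine"
  using pdegree_ge_1[of F] by (simp add: Affine_def)

lemma pcomp_Affine: "F \<in> Affine \<Longrightarrow> G \<in> Affine \<Longrightarrow> F \<circ>\<^sub>p G \<in> Affine"
  using pdegree_pcomp[of F 1 G 1] by (intro AffineI pcomp_Aut) (auto simp: Affine_def)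

lemma AutI:
  assumes "F \<circ>\<^sub>p G = pid" "G \<circ>\<^sub>p F = pid"
  shows "F \<in> Aut"
  unfolding Aut_def using assms by blast

section \<open>Diagonal maps, the swap and shears\<close>

definition diag_map :: "complex \<Rightarrow> complex \<Rightarrow> complex \<Rightarrow> pmap" where
  "diag_map a b c = (bconst a * bX, bconst b * bY + bconst c)"

lemma bev_diag_map [simp]:
  "bev (fst (diag_map a b c)) x y = a * x" "bev (snd (diag_map a b c)) x y = b * y + c"
  by (simp_all add: diag_map_def)

lemma diag_map_degree: "pdegree (diag_map a b c) \<le> 1"
proof -
  have "bdegree (bconst a * bX) \<le> 0 + 1" "bdegree (bconst b * bY) \<le> 0 + 1"
    by (intro bdegree_mult bdegree_bconst bdegree_bX bdegree_bY)+
  moreover have "bdegree (bconst c) \<le> 1" using bdegree_bconst[of c] by simp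
  ultimately show ?thesis
    by (simp add: pdegree_def diag_map_def bdegree_add)
qed

lemma diag_map_Affine:
  assumes "a \<noteq> 0" "b \<noteq> 0"
  shows "diag_map a b c \<in> Affine"
proof (intro AffineI diag_map_degree AutI pmap_eqI)
  fix x y
  let ?G = "diag_map (inverse a) (inverse b) (- c / b)"
  show "bev (fst (diag_map a b c \<circ>\<^sub>p ?G)) x y = bev (fst pid) x y"
    "bev (snd (diag_map a b c \<circ>\<^sub>p ?G)) x y = bev (snd pid) x y"
    "bev (fst (?G \<circ>\<^sub>p diag_map a b c)) x y = bev (fst pid) x y"
    "bev (snd (?G \<circ>\<^sub>p diag_map a b c)) x y = bev (snd pid) x y"
    using assms by (simp_all add: pid_def field_simps)
qed

lemma swap_Affine: "(bY, bX) \<in> Affine"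
proof (intro AffineI AutI[of _ "(bY, bX)"] pmap_eqI)
  show "pdegree (bY, bX) \<le> 1" using bdegree_bX bdegree_bY by (simp add: pdegree_def)
qed (simp_all add: pid_def)

lemma swap_not_Triangular: "(bY, bX) \<notin> Triangular"
proof
  assume "(bY, bX) \<in> Triangular"
  then obtain a b c P where "bY = bconst a * bX + poly_in_Y P" "bX = bconst b * bY + bconst c" "b \<noteq> 0"
    unfolding Triangular_def by auto
  then have "bev bX x y = bev (bconst b * bY + bconst c) x y" for x y by metis
  then have "x = b * y + c" for x y by simp
  from this[of 0 0] this[of 1 0] show False by simp
qed

text \<open>The factor \<open>a\<close> occurs with both signs: 1 for \<open>p\<close> and for the
  limit map, -1 to form Q_s(u) - s Y.\<close>

definition shear :: "complex \<Rightarrow> complex poly \<Rightarrow> pmap" where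
  "shear a P = (bconst a * bX + poly_in_Y P, bY)"

lemma bev_shear [simp]:
  "bev (fst (shear a P)) x y = a * x + poly P y" "bev (snd (shear a P)) x y = y"
  by (simp_all add: shear_def)

lemma shear_Aut:
  assumes "a \<noteq> 0"
  shows "shear a P \<in> Aut"
proof (intro AutI pmap_eqI)
  fix x y
  let ?G = "shear (inverse a) (smult (- inverse a) P)"
  show "bev (fst (shear a P \<circ>\<^sub>p ?G)) x y = bev (fst pid) x y"
    "bev (snd (shear a P \<circ>\<^sub>p ?G)) x y = bev (snd pid) x y"
    "bev (fst (?G \<circ>\<^sub>p shear a P)) x y = bev (fst pid) x y"
    "bev (snd (?G \<circ>\<^sub>p shear a P)) x y = bev (snd pid) x y"
    using assms by (simp_all add: pid_def field_simps)
qed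

lemma pdegree_triangular_le:
  "pdegree (bconst a * bX + poly_in_Y P, bconst b * bY + bconst c) \<le> max 1 (degree P)"
proof -
  have "pdegree (diag_map a b c) \<le> 1" by (rule diag_map_degree)
  then have "bdegree (bconst a * bX) \<le> max 1 (degree P)" "bdegree (bconst b * bY + bconst c) \<le> max 1 (degree P)"
    by (simp_all add: pdegree_def diag_map_def le_max_iff_disj)
  then show ?thesis by (simp add: pdegree_def bdegree_add bdegree_poly_in_Y)
qed

lemma pdegree_triangular_ge:
  "degree P \<le> pdegree (bconst a * bX + poly_in_Y P, G)"
proof (cases "degree P = 0")
  case False
  let ?F = "bconst a * bX + poly_in_Y P"
  have "coeff (coeff ?F (degree P)) 0 = lead_coeff P"
    using False by (cases "degree P") (auto simp: bconst_def bX_def poly_in_Y_def coeff_map_poly coeff_pCons split: nat.splits)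
  moreover have "lead_coeff P \<noteq> 0" using False by auto
  ultimately have "0 + degree P \<le> bdegree ?F"
    by (intro bdegreeD[of ?F "bdegree ?F" "degree P" 0]) auto
  then show ?thesis by (simp add: pdegree_def)
qed simp

lemma shear_eq: "shear a P = (bconst a * bX + poly_in_Y P, bconst 1 * bY + bconst 0)"
  by (rule pmap_eqI) simp_all

lemma pdegree_shear:
  assumes "degree P \<ge> 2"
  shows "pdegree (shear a P) = degree P"
  using assms pdegree_triangular_le[of a P 1 0] pdegree_triangular_ge[of P a]
  unfolding shear_eq by (intro antisym) auto

text \<open>Adding one absorbs the maximum with 1.\<close>

lemma pdegree_shear_le: "degree P \<le> n \<Longrightarrow> pdegree (shear a P) \<le> Suc n"
  using pdegree_triangular_le[of a P 1 0] unfolding shear_eq by auto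

lemma shear_Triangular:
  assumes "a \<noteq> 0" "degree P \<ge> 2"
  shows "shear a P \<in> Triangular - Affine"
proof -
  have "shear a P \<notin> Affine" using pdegree_shear[OF assms(2), of a] assms(2) by (auto simp: Affine_def)
  moreover have "shear a P \<in> Triangular"
    unfolding shear_eq Triangular_def using assms(1)
    by (intro CollectI exI[of _ a] exI[of _ 1] exI[of _ 0] exI[of _ P]) simp
  ultimately show ?thesis by blast
qed

text \<open>Length one forces \<open>k = 1\<close>, and the diagonal part of the single triangular
  factor is absorbed into the affine factor on its left.\<close>

lemma Aut_polydeg_1E:
  assumes "\<theta> \<in> Aut_polydeg [n]" "n \<ge> 2"
  obtains \<alpha> \<beta> R where "\<alpha> \<in> Affine" "\<beta> \<in> Affine" "degree R = n" "\<theta> = \<alpha> \<circ>\<^sub>p shear 1 R \<circ>\<^sub>p \<beta>"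
proof -
  obtain k \<alpha> \<tau> where al: "\<forall>i\<le>k. \<alpha> i \<in> Affine" and ta: "\<forall>i\<in>{1..k}. \<tau> i \<in> Triangular - Affine"
    and th: "\<theta> = alt_prod \<alpha> \<tau> k" and ds: "[n] = map (\<lambda>i. pdegree (\<tau> i)) [1..<k+1]"
  proof -
    have "has_polydegree \<theta> [n]" using assms(1) by (simp add: Aut_polydeg_def)
    then show ?thesis
      unfolding has_polydegree_def by (elim exE conjE) (rule that; assumption)
  qed
  have "k = 1" using arg_cong[OF ds, of length] unfolding length_map length_upt by simp
  then have upt: "[1..<k+1] = [1]" by simp
  have tau: "\<tau> 1 \<in> Triangular" "pdegree (\<tau> 1) = n"
    using bspec[OF ta, of 1] \<open>k = 1\<close> ds unfolding upt by simp_all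
  have th': "\<theta> = \<alpha> 0 \<circ>\<^sub>p \<tau> 1 \<circ>\<^sub>p \<alpha> 1"
    using th \<open>k = 1\<close> by simp
  obtain a b c P where ab: "a \<noteq> 0" "b \<noteq> 0"
    and tau_eq: "\<tau> 1 = (bconst a * bX + poly_in_Y P, bconst b * bY + bconst c)"
    using tau(1) unfolding Triangular_def by blast
  have "degree P = n"
  proof -
    have "degree P \<le> n"
      using pdegree_triangular_ge[of P a "bconst b * bY + bconst c"] unfolding tau_eq[symmetric] tau(2) .
    moreover have "n \<le> max 1 (degree P)"
      using pdegree_triangular_le[of a P b c] unfolding tau_eq[symmetric] tau(2) .
    ultimately show ?thesis using assms(2) by linarith
  qed
  show ?thesis
  proof (rule that)
    show "degree (smult (inverse a) P) = n" using \<open>degree P = n\<close> ab by simp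
    show "\<alpha> 0 \<circ>\<^sub>p diag_map a b c \<in> Affine"
      using al ab by (intro pcomp_Affine diag_map_Affine) simp_all
    show "\<alpha> 1 \<in> Affine" using al \<open>k = 1\<close> by simp
    have "\<tau> 1 = diag_map a b c \<circ>\<^sub>p shear 1 (smult (inverse a) P)"
      unfolding tau_eq by (rule pmap_eqI) (use ab in \<open>simp_all add: distrib_left\<close>)
    then show "\<theta> = (\<alpha> 0 \<circ>\<^sub>p diag_map a b c) \<circ>\<^sub>p shear 1 (smult (inverse a) P) \<circ>\<^sub>p \<alpha> 1"
      unfolding th' by (simp only: pcomp_assoc)
  qed
qed

lemma Aut_polydeg_2I:
  assumes aff: "\<alpha> \<in> Affine" "\<beta> \<in> Affine" "\<gamma> \<in> Affine" "\<beta> \<notin> Triangular"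
    and tri: "\<sigma> \<in> Triangular - Affine" "\<tau> \<in> Triangular - Affine" "\<sigma> \<in> Aut" "\<tau> \<in> Aut"
  shows "\<alpha> \<circ>\<^sub>p \<sigma> \<circ>\<^sub>p \<beta> \<circ>\<^sub>p \<tau> \<circ>\<^sub>p \<gamma> \<in> Aut_polydeg [pdegree \<sigma>, pdegree \<tau>]"
proof -
  define as where "as i = (if i = 0 then \<alpha> else if i = 1 then \<beta> else \<gamma>)" for i :: nat
  define ts where "ts i = (if i = 1 then \<sigma> else \<tau>)" for i :: nat
  have two: "2 = Suc (Suc 0)" by simp
  have "has_polydegree (\<alpha> \<circ>\<^sub>p \<sigma> \<circ>\<^sub>p \<beta> \<circ>\<^sub>p \<tau> \<circ>\<^sub>p \<gamma>) [pdegree \<sigma>, pdegree \<tau>]"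
    unfolding has_polydegree_def
  proof (intro exI conjI)
    show "\<forall>i\<le>2. as i \<in> Affine" "\<forall>i\<in>{1..2}. ts i \<in> Triangular - Affine"
      using aff tri by (auto simp: as_def ts_def)
    show "\<forall>i. 0 < i \<and> i < 2 \<longrightarrow> as i \<notin> Triangular"
      using aff(4) by (auto simp: as_def)
    show "\<alpha> \<circ>\<^sub>p \<sigma> \<circ>\<^sub>p \<beta> \<circ>\<^sub>p \<tau> \<circ>\<^sub>p \<gamma> = alt_prod as ts 2"
      by (simp add: two as_def ts_def)
    show "[pdegree \<sigma>, pdegree \<tau>] = map (\<lambda>i. pdegree (ts i)) [1..<2 + 1]"
      by (simp add: two ts_def upt_rec)
  qed
  moreover have "\<alpha> \<circ>\<^sub>p \<sigma> \<circ>\<^sub>p \<beta> \<circ>\<^sub>p \<tau> \<circ>\<^sub>p \<gamma> \<in> Aut"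
    using aff tri by (auto intro!: pcomp_Aut simp: Affine_def)
  ultimately show ?thesis by (simp add: Aut_polydeg_def)
qed

lemma bev_tendsto:
  assumes "(f \<longlongrightarrow> a) F" "(g \<longlongrightarrow> b) F"
  shows "((\<lambda>s. bev P (f s) (g s)) \<longlongrightarrow> bev P a b) F"
  unfolding bev_sum_coeffs by (intro tendsto_intros assms)

theorem theorem4:
  fixes d e :: nat
  assumes "d \<ge> 2" and "e \<ge> 1"
    and "\<exists>\<psi> :: nat mpoly \<Rightarrow> complex. alg_hom_on {1..e} \<psi> \<and>
           (\<forall>i. i + 2 \<le> e \<longrightarrow> \<psi> (gpoly (d + i) e) = 0) \<and>
           \<psi> (gpoly (d + e - 1) e) \<noteq> 0 \<and>
           \<psi> (apoly d e) \<noteq> 0"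
  shows "Aut_polydeg [d + e] \<subseteq> ind_topology closure_of (Aut_polydeg [d, e + 1])"
proof
  fix \<theta> assume th: "\<theta> \<in> Aut_polydeg [d + e]"
  obtain \<psi> where hom: "alg_hom_on {1..e} \<psi>"
    and psi: "\<forall>i. i + 2 \<le> e \<longrightarrow> \<psi> (gpoly (d + i) e) = 0" "\<psi> (gpoly (d + e - 1) e) \<noteq> 0" "\<psi> (apoly d e) \<noteq> 0"
    using assms(3) by blast
  obtain \<phi> where phi: "\<And>p. p \<in> polys_in {1..e} \<Longrightarrow> \<psi> p = mp_eval \<phi> p"
    using alg_hom_on_eq_mp_eval[OF hom] by blast
  have zero: "lag e \<phi> (d + i) = 0" if "i + 2 \<le> e" for i
    using psi(1) that by (simp add: phi gpoly_in mp_eval_gpoly del: One_nat_def)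
  have nonzero: "lag e \<phi> (d + e - 1) \<noteq> 0"
    using psi(2) by (simp add: phi gpoly_in mp_eval_gpoly del: One_nat_def)
  have "mp_eval \<phi> (apoly d e) \<noteq> 0"
    using psi(3) by (simp add: phi apoly_in del: One_nat_def)
  then obtain M where M: "\<And>l m. l < e \<Longrightarrow> m < e \<Longrightarrow>
      (\<Sum>i<e. lag_slope e \<phi> \<phi> (d + l) (Suc i) * M i m) = (if l = m then 1 else 0)"
    using slope_inverse[of d \<phi> e] assms(1) by (metis One_nat_def Suc_leD numeral_2_eq_2)
  have "d + e \<ge> 2" using assms by simp
  obtain \<alpha> \<beta> R where aff: "\<alpha> \<in> Affine" "\<beta> \<in> Affine" and R: "degree R = d + e"
    and th_eq: "\<theta> = \<alpha> \<circ>\<^sub>p shear 1 R \<circ>\<^sub>p \<beta>"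
    by (rule Aut_polydeg_1E[OF th \<open>d + e \<ge> 2\<close>])
  obtain \<rho> p Q where rho: "\<rho> \<noteq> 0" and deg: "\<And>s. degree (p s) \<le> Suc e" "\<And>s. degree (Q s) \<le> d"
    and deg_eq: "eventually (\<lambda>s. degree (p s) = Suc e \<and> degree (Q s) = d) (at 0)"
    and lim: "\<And>x y. ((\<lambda>s. (poly (Q s) (\<rho> * s ^ (d + e) * x + poly (p s) (s * y)) - s * y) / (\<rho> * s ^ (d + e)))
       \<longlongrightarrow> x + poly R y) (at 0)"
    "\<And>x y. ((\<lambda>s. (\<rho> * s ^ (d + e) * x + poly (p s) (s * y)) / s) \<longlongrightarrow> y) (at 0)"
    by (rule degeneration[OF assms(1,2) R M zero nonzero]) blast+
  define \<kappa> where "\<kappa> s = \<rho> * s ^ (d + e)" for s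
  \<comment> \<open>Read from the right, after \<open>\<beta>\<close>: scaling gives
    \<open>(\<kappa> x, s y)\<close>, the shear by \<open>p\<close> gives \<open>(u, s y)\<close>,
    the swap and the shear by \<open>Q\<close> give \<open>(Q u - s y, u)\<close>, and the last
    scaling divides by \<open>\<kappa>\<close> and \<open>s\<close>. The swap is affine and not
    triangular, so the word is reduced.\<close>
  define \<sigma> where "\<sigma> s = (\<alpha> \<circ>\<^sub>p diag_map (inverse (\<kappa> s)) (inverse s) 0) \<circ>\<^sub>p shear (- 1) (Q s) \<circ>\<^sub>p
    (bY, bX) \<circ>\<^sub>p shear 1 (p s) \<circ>\<^sub>p (diag_map (\<kappa> s) s 0 \<circ>\<^sub>p \<beta>)" for s
  \<comment> \<open>The product of the degree bounds of the factors, bracketed like the composition.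
    It holds for every \<open>s\<close>, including 0, where the scalings degenerate.\<close>
  define n where "n = (1 * 1) * Suc d * 1 * Suc (Suc e) * (1 * 1)"
  have th_Aut: "\<theta> \<in> Aut" using th by (simp add: Aut_polydeg_def)
  show "\<theta> \<in> ind_topology closure_of (Aut_polydeg [d, e + 1])"
  proof (rule in_closure_ind_topology)
    show "at (0::complex) \<noteq> bot" by simp
    show "Aut_polydeg [d, e + 1] \<subseteq> Aut" by (auto simp: Aut_polydeg_def)
    show "\<theta> \<in> Aut" by (rule th_Aut)
    show "eventually (\<lambda>s. \<sigma> s \<in> Aut_polydeg [d, e + 1]) (at 0)"
      using deg_eq eventually_neq_at_within[of 0]
    proof eventually_elim
      case (elim s)
      then have k: "\<kappa> s \<noteq> 0" "s \<noteq> 0" and dg: "degree (p s) = e + 1" "degree (Q s) = d"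
        using rho by (auto simp: \<kappa>_def)
      have d2: "degree (p s) \<ge> 2" "degree (Q s) \<ge> 2" using dg assms by auto
      have "\<sigma> s \<in> Aut_polydeg [pdegree (shear (- 1) (Q s)), pdegree (shear 1 (p s))]"
        unfolding \<sigma>_def
        by (intro Aut_polydeg_2I pcomp_Affine aff diag_map_Affine swap_Affine swap_not_Triangular
            shear_Triangular shear_Aut d2) (use k in auto)
      then show ?case unfolding pdegree_shear[OF d2(1)] pdegree_shear[OF d2(2)] dg .
    qed
    have pd: "pdegree \<alpha> \<le> 1" "pdegree \<beta> \<le> 1" "pdegree (bY, bX) \<le> 1"
      using aff swap_Affine by (simp_all add: Affine_def)
    show "pdegree (\<sigma> s) \<le> max n (pdegree \<theta>)" for s
    proof -
      have "pdegree (\<sigma> s) \<le> n"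
        unfolding \<sigma>_def n_def by (intro pdegree_pcomp pd diag_map_degree pdegree_shear_le deg)
      then show ?thesis by simp
    qed
    show "pdegree \<theta> \<le> max n (pdegree \<theta>)" by simp
    fix x y
    define x' y' where "x' = bev (fst \<beta>) x y" and "y' = bev (snd \<beta>) x y"
    define u where "u s = \<kappa> s * x' + poly (p s) (s * y')" for s
    have l1: "((\<lambda>s. inverse (\<kappa> s) * (poly (Q s) (u s) - s * y')) \<longlongrightarrow> x' + poly R y') (at 0)"
      using lim(1)[of x' y'] unfolding u_def \<kappa>_def by (simp add: divide_inverse mult.commute)
    have l2: "((\<lambda>s. inverse s * u s) \<longlongrightarrow> y') (at 0)"
      using lim(2)[of x' y'] unfolding u_def \<kappa>_def by (simp add: divide_inverse mult.commute)
    \<comment> \<open>The map \<open>\<beta>\<close> only moves the point of evaluation and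
      \<open>\<alpha>\<close> is continuous, so the limits obtained for (X + R(Y), Y) carry
      over.\<close>
    show "((\<lambda>s. bev (fst (\<sigma> s)) x y) \<longlongrightarrow> bev (fst \<theta>) x y) (at 0)"
      "((\<lambda>s. bev (snd (\<sigma> s)) x y) \<longlongrightarrow> bev (snd \<theta>) x y) (at 0)"
      using bev_tendsto[OF l1 l2]
      by (simp_all add: \<sigma>_def th_eq u_def x'_def y'_def)
  qed
qed

end
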